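(* Fix positive integers $i,j$ with $i\ne j$. Let $V^{(N)}=(v^{(N)}_{ij})$, $N\ge 1$, be a sequence of $N\times N$ COE matrices. Then, as $N\to\infty$, both $\sqrt{N/2}\,v^{(N)}_{ii}$ and $\sqrt{N}\,v^{(N)}_{ij}$ converge in distribution to a standard complex Gaussian random variable.
   Context: An $N\times N$ COE (circular orthogonal ensemble) matrix is a random symmetric unitary matrix $V$ distributed as $V=U^{\top}U$, where $U=(u_{ij})_{1\le i,j\le N}$ is a Haar-distributed random matrix from the unitary group $U(N)$ and $U^{\top}$ is its transpose (no complex conjugation); that is, $v_{ij}=\sum_{k=1}^N u_{ki}u_{kj}$. The entry $v^{(N)}_{ij}$ is defined for $N\ge\max(i,j)$. A standard complex Gaussian random variable $Z$ is one whose real and imaginary parts are independent centered real Gaussians of variance $1/2$, so that $\mathbb{E}[Z^n\overline{Z}^m]=\delta_{n,m}\,n!$. The convergence statements concern each of the two sequences separately. *)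

theory Defs
  imports "HOL-Probability.Probability" "Jordan_Normal_Form.Schur_Decomposition"
begin

(* The sigma-algebra generated by the entries; as the complex numbers are second countable,
   this is the Borel sigma-algebra of the N x N complex matrices. *)
definition mat_borel :: "nat \<Rightarrow> complex mat measure" where
  "mat_borel N = vimage_algebra (carrier_mat N N)
     (\<lambda>A. \<lambda>p\<in>{..<N} \<times> {..<N}. A $$ p) (\<Pi>\<^sub>M p\<in>{..<N} \<times> {..<N}. (borel :: complex measure))"

definition unitary_group :: "nat \<Rightarrow> complex mat set" where
  "unitary_group N = {A \<in> carrier_mat N N. mat_adjoint A * A = 1\<^sub>m N}"

(* Haar measure on U(N), normalised to a probability measure and characterised by left
   invariance. *)
definition haar_unitary :: "nat \<Rightarrow> complex mat measure \<Rightarrow> bool" where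
  "haar_unitary N \<mu> \<longleftrightarrow>
     prob_space \<mu> \<and>
     sets \<mu> = sets (restrict_space (mat_borel N) (unitary_group N)) \<and>
     (\<forall>A\<in>unitary_group N. distr \<mu> \<mu> (\<lambda>U. A * U) = \<mu>)"

(* Only the law of V is prescribed: V need not come with a Haar matrix on its own
   probability space. *)
definition coe_matrix :: "nat \<Rightarrow> 'a measure \<Rightarrow> ('a \<Rightarrow> complex mat) \<Rightarrow> bool" where
  "coe_matrix N M V \<longleftrightarrow>
     prob_space M \<and> V \<in> measurable M (mat_borel N) \<and>
     (\<exists>\<mu>. haar_unitary N \<mu> \<and>
          distr M (mat_borel N) V = distr \<mu> (mat_borel N) (\<lambda>U. U\<^sup>T * U))"

definition std_complex_gaussian :: "complex measure" where
  "std_complex_gaussian =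
     distr (density lborel (normal_density 0 (sqrt (1/2))) \<Otimes>\<^sub>M
            density lborel (normal_density 0 (sqrt (1/2))))
       borel (\<lambda>(x, y). Complex x y)"

(* Convergence in distribution of random variables X n, each on its own probability space M n,
   to the probability law L. The library's weak_conv only covers real-valued variables. *)
definition converges_in_distribution ::
    "(nat \<Rightarrow> 'a measure) \<Rightarrow> (nat \<Rightarrow> 'a \<Rightarrow> 'b::topological_space) \<Rightarrow> 'b measure \<Rightarrow> bool" where
  "converges_in_distribution M X L \<longleftrightarrow>
     (\<forall>f :: 'b \<Rightarrow> real. continuous_on UNIV f \<longrightarrow> bounded (range f) \<longrightarrow>
        (\<lambda>n. \<integral>\<omega>. f (X n \<omega>) \<partial>M n) \<longlonglongrightarrow> (\<integral>x. f x \<partial>L))"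

end

theory Submission
  imports Defs "HOL-Real_Asymp.Real_Asymp"
begin

text \<open>
  Write \<open>x\<close>, \<open>y\<close> for two columns of \<open>U\<close>, so that the entries of \<open>V\<close> are \<open>p = x\<^sup>T x\<close> and
  \<open>v = x\<^sup>T y\<close>. Left invariance of Haar measure under the one-parameter groups \<open>exp (i \<theta> w w\<^sup>*)\<close> gives
  integration-by-parts identities for the derivations \<open>D\<^sub>a\<^sub>b\<close> that span the complexified Lie algebra.
  The vector fields with coefficients \<open>cnj (x\<^sub>a x\<^sub>b)\<close> and
  \<open>(cnj x\<^sub>a - cnj p x\<^sub>a) cnj y\<^sub>b\<close> (the latter fixes \<open>x\<close>) close up on the moments, and yield
  the exact laws \<open>\<bar>p\<bar>\<^sup>2 \<sim> 1 - s\<^bsup>2/(N-1)\<^esup>\<close> and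
  \<open>\<bar>v\<bar>\<^sup>2 \<sim> q\<^bsup>2/(N-1)\<^esup> (1 - s\<^bsup>1/(N-2)\<^esup>)\<close> with \<open>s\<close>, \<open>q\<close> independent and uniform on \<open>(0, 1)\<close>.
  Rescaled, both tend to \<open>- ln s\<close>, which is the law of \<open>\<bar>Z\<bar>\<^sup>2\<close>; the laws of \<open>p\<close>, \<open>v\<close> and \<open>Z\<close>
  are invariant under rotation, hence determined by the law of the modulus.
\<close>

section \<open>Unitary matrices and one-parameter subgroups\<close>

text \<open>The obstacle is closure of the moment equations. With the plain coefficients
  \<open>cnj x_a * cnj y_b\<close> the image of \<open>cnj v\<close> contains \<open>cnj p\<close>
  times the conjugate of the other diagonal entry \<open>y\<^sup>T y\<close>, so the recursion would
  bring in further entries. Subtracting \<open>cnj p * x_a\<close> makes the first factor orthogonal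
  to \<open>x\<close> and removes that term. The price is that \<open>v\<close> is sent to
  \<open>1 - |p|^2\<close> instead of 1; this is affordable because the corrected field annihilates
  both \<open>p\<close> and \<open>cnj p\<close>, so that powers of \<open>1 - |p|^2\<close> pass
  through as constants and the recursion gains a second index. The limit is reached through exact
  laws rather than through limits of moments. At finite \<open>N\<close> the squared moduli live in
  the compact interval from 0 to 1, where polynomial approximation settles the moment problem, and
  once every law is realised on one space convergence in distribution becomes pointwise convergence.
  The exponents are those of beta laws: Beta(1, (N-1)/2) for \<open>|p|^2\<close> and, given
  \<open>p\<close>, Beta(1, N-2) for \<open>|v|^2 / (1 - |p|^2)\<close>, as for one coordinate of a
  uniform point on the unit sphere in dimension \<open>N - 1\<close>.\<close>

abbreviation unitary_borel :: "nat \<Rightarrow> complex mat measure" where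
  "unitary_borel N \<equiv> restrict_space (mat_borel N) (unitary_group N)"

lemma space_mat_borel [simp]: "space (mat_borel N) = carrier_mat N N"
  by (simp add: mat_borel_def)

lemma unitary_group_carrier: "U \<in> unitary_group N \<Longrightarrow> U \<in> carrier_mat N N"
  by (simp add: unitary_group_def)

lemma space_unitary_borel [simp]: "space (unitary_borel N) = unitary_group N"
  using unitary_group_carrier by (auto simp: space_restrict_space)

lemma measurable_mat_entry:
  assumes "k < N" "c < N"
  shows "(\<lambda>A. A $$ (k, c)) \<in> borel_measurable (mat_borel N)"
proof -
  have "(\<lambda>A. \<lambda>p\<in>{..<N} \<times> {..<N}. A $$ p) \<in> mat_borel N \<rightarrow>\<^sub>M (\<Pi>\<^sub>M p\<in>{..<N} \<times> {..<N}. (borel :: complex measure))"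
    unfolding mat_borel_def by (rule measurable_vimage_algebra1) (auto simp: space_PiM)
  from measurable_compose[OF this measurable_component_singleton[of "(k, c)"]] assms
  show ?thesis by simp
qed

lemma measurable_into_mat_borel:
  assumes "\<And>x. x \<in> space M \<Longrightarrow> f x \<in> carrier_mat N N"
    and "\<And>k c. k < N \<Longrightarrow> c < N \<Longrightarrow> (\<lambda>x. f x $$ (k, c)) \<in> borel_measurable M"
  shows "f \<in> M \<rightarrow>\<^sub>M mat_borel N"
  unfolding mat_borel_def
proof (rule measurable_vimage_algebra2)
  show "f \<in> space M \<rightarrow> carrier_mat N N" using assms by auto
  show "(\<lambda>x. \<lambda>p\<in>{..<N} \<times> {..<N}. f x $$ p) \<in> M \<rightarrow>\<^sub>M (\<Pi>\<^sub>M p\<in>{..<N} \<times> {..<N}. borel)"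
    by (rule measurable_restrict) (use assms in auto)
qed

lemma measurable_unitary_entry [measurable]:
  assumes "k < N" "c < N"
  shows "(\<lambda>U. U $$ (k, c)) \<in> borel_measurable (unitary_borel N)"
  using measurable_mat_entry[OF assms] by (rule measurable_restrict_space1)

lemma mat_mult_entry:
  assumes "A \<in> carrier_mat N N" "B \<in> carrier_mat N N" "k < N" "c < N"
  shows "(A * B) $$ (k, c) = (\<Sum>l<N. A $$ (k, l) * B $$ (l, c))"
  using assms by (auto simp: scalar_prod_def lessThan_atLeast0 intro!: sum.cong)

lemma mat_adjoint_carrier:
  "A \<in> carrier_mat N N \<Longrightarrow> mat_adjoint A \<in> carrier_mat N N"
  by (auto simp: mat_adjoint_def)

lemma mat_adjoint_entry:
  assumes "A \<in> carrier_mat N N" "k < N" "c < N"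
  shows "mat_adjoint A $$ (k, c) = cnj (A $$ (c, k))"
  using assms by (auto simp: mat_adjoint_def mat_of_rows_def)

lemma unitary_group_iff:
  "A \<in> unitary_group N \<longleftrightarrow> A \<in> carrier_mat N N \<and>
     (\<forall>c<N. \<forall>d<N. (\<Sum>k<N. cnj (A $$ (k, c)) * A $$ (k, d)) = (if c = d then 1 else 0))"
  (is "_ \<longleftrightarrow> _ \<and> ?orth")
proof (cases "A \<in> carrier_mat N N")
  case True
  have e: "(mat_adjoint A * A) $$ (c, d) = (\<Sum>k<N. cnj (A $$ (k, c)) * A $$ (k, d))"
    if "c < N" "d < N" for c d
    by (subst mat_mult_entry[OF mat_adjoint_carrier[OF True] True that])
       (auto intro!: sum.cong simp: mat_adjoint_entry[OF True] that)
  have "mat_adjoint A * A = 1\<^sub>m N \<longleftrightarrow> ?orth"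
  proof
    assume "mat_adjoint A * A = 1\<^sub>m N"
    then show ?orth using e by (metis index_one_mat(1))
  next
    assume ?orth
    then show "mat_adjoint A * A = 1\<^sub>m N"
      using True carrier_matD[OF mat_adjoint_carrier[OF True]]
      by (intro eq_matI) (simp_all add: e del: index_mult_mat(1))
  qed
  with True show ?thesis by (simp add: unitary_group_def)
qed (simp add: unitary_group_def)

lemma unitary_orthonormal:
  assumes "U \<in> unitary_group N" "c < N" "d < N"
  shows "(\<Sum>k<N. cnj (U $$ (k, c)) * U $$ (k, d)) = (if c = d then 1 else 0)"
  using assms unitary_group_iff by blast

lemma unitary_column_norm:
  assumes "U \<in> unitary_group N" "c < N"
  shows "(\<Sum>k<N. (cmod (U $$ (k, c)))\<^sup>2) = 1"
proof -
  have "complex_of_real (\<Sum>k<N. (cmod (U $$ (k, c)))\<^sup>2) = 1"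
    using unitary_orthonormal[OF assms assms(2)]
    by (simp add: complex_norm_square mult.commute del: of_real_power)
  then show ?thesis using of_real_eq_1_iff by blast
qed

lemma unitary_entry_bound:
  assumes "U \<in> unitary_group N" "k < N" "c < N"
  shows "cmod (U $$ (k, c)) \<le> 1"
proof -
  have "(cmod (U $$ (k, c)))\<^sup>2 \<le> (\<Sum>k<N. (cmod (U $$ (k, c)))\<^sup>2)"
    by (rule member_le_sum) (use assms in auto)
  then show ?thesis
    using unitary_column_norm[OF assms(1,3)] by (simp add: power_le_one_iff)
qed

text \<open>Left multiplication by \<open>R\<^sub>\<theta> = I + ((e\<^sup>i\<^sup>\<theta>\<^sup>s - 1) / s) w w\<^sup>*\<close>, where \<open>s = \<parallel>w\<parallel>\<^sup>2\<close>, that is, by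
  \<open>exp (i \<theta> w w\<^sup>*)\<close>. For \<open>w = 0\<close> the junk value \<open>0 / 0 = 0\<close> is harmless.\<close>

definition phase_coeff :: "nat \<Rightarrow> (nat \<Rightarrow> complex) \<Rightarrow> real \<Rightarrow> complex" where
  "phase_coeff N w \<theta> =
     (let s = (\<Sum>k<N. (cmod (w k))\<^sup>2) in (cis (\<theta> * s) - 1) / of_real s)"

definition phase_mat :: "nat \<Rightarrow> (nat \<Rightarrow> complex) \<Rightarrow> real \<Rightarrow> complex mat" where
  "phase_mat N w \<theta> = mat N N (\<lambda>(k, l).
     (if k = l then 1 else 0) + phase_coeff N w \<theta> * (w k * cnj (w l)))"

lemma phase_mat_carrier [simp]: "phase_mat N w \<theta> \<in> carrier_mat N N"
  by (simp add: phase_mat_def)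

lemma phase_mat_mult_entry:
  assumes "U \<in> carrier_mat N N" "k < N" "c < N"
  shows "(phase_mat N w \<theta> * U) $$ (k, c) =
     U $$ (k, c) + phase_coeff N w \<theta> * (w k * (\<Sum>l<N. cnj (w l) * U $$ (l, c)))"
proof -
  have "(phase_mat N w \<theta> * U) $$ (k, c) = (\<Sum>l<N. phase_mat N w \<theta> $$ (k, l) * U $$ (l, c))"
    by (rule mat_mult_entry) (use assms in auto)
  also have "\<dots> = (\<Sum>l<N. (if k = l then U $$ (l, c) else 0)
       + phase_coeff N w \<theta> * (w k * (cnj (w l) * U $$ (l, c))))"
    using assms by (intro sum.cong) (auto simp: phase_mat_def algebra_simps)
  also have "\<dots> = U $$ (k, c) + phase_coeff N w \<theta> * (w k * (\<Sum>l<N. cnj (w l) * U $$ (l, c)))"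
    using assms by (simp add: sum.distrib sum_distrib_left)
  finally show ?thesis .
qed

lemma phase_coeff_0 [simp]: "phase_coeff N w 0 = 0"
  by (simp add: phase_coeff_def)

text \<open>Since \<open>1 + s * phase_coeff N w \<theta>\<close> is
  \<open>cis (\<theta> * s)\<close>, this is the multiplicativity of \<open>cis\<close> divided by
  \<open>s\<close>. It persists at \<open>s = 0\<close>, where every quotient is 0.\<close>

lemma phase_coeff_add:
  "phase_coeff N w (\<theta> + \<phi>) = phase_coeff N w \<theta> + phase_coeff N w \<phi>
     + of_real (\<Sum>k<N. (cmod (w k))\<^sup>2) * phase_coeff N w \<theta> * phase_coeff N w \<phi>"
proof -
  have ident: "(a * b - 1) / s = (a - 1) / s + (b - 1) / s + s * ((a - 1) / s) * ((b - 1) / s)"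
    for a b s :: complex
    by (cases "s = 0") (simp_all add: field_simps)
  show ?thesis
    unfolding phase_coeff_def Let_def distrib_right cis_mult[symmetric] by (rule ident)
qed

lemma cnj_phase_coeff: "cnj (phase_coeff N w \<theta>) = phase_coeff N w (- \<theta>)"
  by (simp add: phase_coeff_def Let_def cis_cnj)

lemma sum_cnj_self: "(\<Sum>l<N. cnj (w l) * w l) = of_real (\<Sum>k<N. (cmod (w k))\<^sup>2)"
  by (simp add: complex_norm_square mult.commute del: of_real_power)

lemma phase_mat_unitary: "phase_mat N w \<theta> \<in> unitary_group N"
  unfolding unitary_group_iff
proof (intro conjI allI impI)
  fix c d assume cd: "c < N" "d < N"
  define s where "s = (\<Sum>k<N. (cmod (w k))\<^sup>2)"
  define p where "p = phase_coeff N w \<theta>"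
  \<comment> \<open>Conjugation reverses the angle, so unitarity reduces to the addition law at
    \<open>- \<theta> + \<theta> = 0\<close>.\<close>
  have z: "cnj p + p + of_real s * cnj p * p = 0"
    using phase_coeff_add[of N w "-\<theta>" \<theta>] by (simp add: p_def s_def cnj_phase_coeff)
  have "(\<Sum>k<N. cnj (phase_mat N w \<theta> $$ (k, c)) * phase_mat N w \<theta> $$ (k, d)) =
     (\<Sum>k<N. (if k = c then (if k = d then 1 else 0) else 0)
        + (if k = c then p * (w k * cnj (w d)) else 0)
        + (if k = d then cnj p * (cnj (w k) * w c) else 0)
        + cnj p * p * w c * cnj (w d) * (cnj (w k) * w k))"
    using cd by (intro sum.cong) (auto simp: phase_mat_def p_def algebra_simps)
  also have "\<dots> = (if c = d then 1 else 0) + (cnj p + p + of_real s * cnj p * p) * (w c * cnj (w d))"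
    using cd by (simp only: sum.distrib sum_distrib_left[symmetric] sum_cnj_self s_def[symmetric])
      (simp add: algebra_simps)
  finally show "(\<Sum>k<N. cnj (phase_mat N w \<theta> $$ (k, c)) * phase_mat N w \<theta> $$ (k, d))
      = (if c = d then 1 else 0)" by (simp add: z)
qed simp

lemma unitary_mult:
  assumes "A \<in> unitary_group N" "B \<in> unitary_group N"
  shows "A * B \<in> unitary_group N"
proof -
  have car: "A \<in> carrier_mat N N" "B \<in> carrier_mat N N"
    using assms unitary_group_carrier by auto
  have "(\<Sum>k<N. cnj ((A * B) $$ (k, c)) * (A * B) $$ (k, d)) = (if c = d then 1 else 0)"
    if cd: "c < N" "d < N" for c d
  proof -
    have "(\<Sum>k<N. cnj ((A * B) $$ (k, c)) * (A * B) $$ (k, d)) =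
      (\<Sum>k<N. \<Sum>l<N. \<Sum>m<N. (cnj (A $$ (k, l)) * A $$ (k, m)) * (cnj (B $$ (l, c)) * B $$ (m, d)))"
    proof (intro sum.cong refl)
      fix k assume "k \<in> {..<N}"
      then show "cnj ((A * B) $$ (k, c)) * (A * B) $$ (k, d) =
        (\<Sum>l<N. \<Sum>m<N. (cnj (A $$ (k, l)) * A $$ (k, m)) * (cnj (B $$ (l, c)) * B $$ (m, d)))"
        using cd by (simp add: mat_mult_entry[OF car] sum_product cnj_sum del: index_mult_mat(1))
          (simp add: ac_simps)
    qed
    also have "\<dots> = (\<Sum>l<N. \<Sum>m<N. (\<Sum>k<N. cnj (A $$ (k, l)) * A $$ (k, m)) * (cnj (B $$ (l, c)) * B $$ (m, d)))"
      unfolding sum_distrib_right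
      by (rule trans[OF sum.swap], rule sum.cong, rule refl, rule sum.swap)
    also have "\<dots> = (\<Sum>l<N. \<Sum>m<N. if l = m then cnj (B $$ (l, c)) * B $$ (m, d) else 0)"
      by (intro sum.cong refl) (simp add: unitary_orthonormal[OF assms(1)])
    also have "\<dots> = (if c = d then 1 else 0)"
      using unitary_orthonormal[OF assms(2) cd] by simp
    finally show ?thesis .
  qed
  with car show ?thesis by (simp add: unitary_group_iff)
qed

lemma phase_mat_add_mult:
  assumes "U \<in> carrier_mat N N"
  shows "phase_mat N w (\<theta> + \<phi>) * U = phase_mat N w \<phi> * (phase_mat N w \<theta> * U)"
proof (rule eq_matI)
  fix k c
  assume "k < dim_row (phase_mat N w \<phi> * (phase_mat N w \<theta> * U))"
    and "c < dim_col (phase_mat N w \<phi> * (phase_mat N w \<theta> * U))"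
  then have kc: "k < N" "c < N" using assms by (auto simp: phase_mat_def)
  have car: "phase_mat N w \<theta> * U \<in> carrier_mat N N"
    using assms by (metis mult_carrier_mat phase_mat_carrier)
  define S where "S = (\<Sum>l<N. cnj (w l) * U $$ (l, c))"
  define s where "s = (\<Sum>k<N. (cmod (w k))\<^sup>2)"
  have "(\<Sum>l<N. cnj (w l) * (phase_mat N w \<theta> * U) $$ (l, c))
      = (\<Sum>l<N. cnj (w l) * U $$ (l, c) + phase_coeff N w \<theta> * S * (cnj (w l) * w l))"
    using kc by (intro sum.cong refl)
      (auto simp: phase_mat_mult_entry[OF assms] S_def[symmetric] algebra_simps)
  also have "\<dots> = S + phase_coeff N w \<theta> * S * of_real s"
    by (simp add: sum.distrib sum_distrib_left[symmetric] sum_cnj_self s_def[symmetric] S_def[symmetric])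
  finally have "(phase_mat N w \<phi> * (phase_mat N w \<theta> * U)) $$ (k, c) =
      U $$ (k, c) + phase_coeff N w \<theta> * (w k * S)
        + phase_coeff N w \<phi> * (w k * (S + phase_coeff N w \<theta> * S * of_real s))"
    by (simp add: phase_mat_mult_entry[OF car kc] phase_mat_mult_entry[OF assms kc] S_def[symmetric])
  also have "\<dots> = U $$ (k, c) + phase_coeff N w (\<theta> + \<phi>) * (w k * S)"
    by (simp add: phase_coeff_add s_def[symmetric] algebra_simps)
  also have "\<dots> = (phase_mat N w (\<theta> + \<phi>) * U) $$ (k, c)"
    by (simp add: phase_mat_mult_entry[OF assms kc] S_def[symmetric])
  finally show "(phase_mat N w (\<theta> + \<phi>) * U) $$ (k, c)
      = (phase_mat N w \<phi> * (phase_mat N w \<theta> * U)) $$ (k, c)" ..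
qed (use assms in \<open>auto simp: phase_mat_def\<close>)

lemma phase_mat_0: "U \<in> carrier_mat N N \<Longrightarrow> phase_mat N w 0 * U = U"
  by (rule eq_matI) (auto simp: phase_mat_mult_entry simp del: index_mult_mat(1), auto simp: phase_mat_def)

text \<open>The factor \<open>w k\<close> belongs to the statement: for \<open>w = 0\<close> the
  coefficient alone is identically 0 and its derivative is not \<i>, whereas the product has the
  right derivative in both cases.\<close>

lemma phase_coeff_deriv:
  assumes "k < N"
  shows "((\<lambda>\<theta>. phase_coeff N w \<theta> * w k) has_vector_derivative \<i> * w k) (at 0)"
proof (cases "(\<Sum>k<N. (cmod (w k))\<^sup>2) = 0")
  case True
  then have "w k = 0"
    using assms by (subst (asm) sum_nonneg_eq_0_iff) auto
  then show ?thesis by simp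
next
  case False
  have "((\<lambda>\<theta>. (cis (\<theta> * s) - 1) / of_real s) has_vector_derivative \<i>) (at 0)"
    if "s \<noteq> 0" for s :: real
  proof -
    have "((\<lambda>z. (exp (\<i> * z * of_real s) - 1) / of_real s) has_field_derivative \<i>) (at (of_real 0))"
      using that by (auto intro!: derivative_eq_intros)
    from has_vector_derivative_real_field[OF this] show ?thesis
      by (simp add: cis_conv_exp mult.assoc)
  qed
  from this[OF False] have "((\<lambda>\<theta>. phase_coeff N w \<theta>) has_vector_derivative \<i>) (at 0)"
    by (simp add: phase_coeff_def Let_def)
  then show ?thesis
    by (auto intro!: derivative_eq_intros)
qed

section \<open>Integration by parts for Haar measure\<close>

lemma haar_unitaryD:
  assumes "haar_unitary N \<mu>"
  shows "prob_space \<mu>" "sets \<mu> = sets (unitary_borel N)" "space \<mu> = unitary_group N"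
proof -
  show "prob_space \<mu>" and s: "sets \<mu> = sets (unitary_borel N)"
    using assms by (auto simp: haar_unitary_def)
  show "space \<mu> = unitary_group N"
    using sets_eq_imp_space_eq[OF s] by simp
qed

lemma measurable_unitary_mult:
  assumes "A \<in> unitary_group N"
  shows "(\<lambda>U. A * U) \<in> unitary_borel N \<rightarrow>\<^sub>M unitary_borel N"
proof (rule measurable_restrict_space2)
  show "(\<lambda>U. A * U) \<in> space (unitary_borel N) \<rightarrow> unitary_group N"
    using unitary_mult[OF assms] by auto
  show "(\<lambda>U. A * U) \<in> unitary_borel N \<rightarrow>\<^sub>M mat_borel N"
  proof (rule measurable_into_mat_borel)
    fix U assume "U \<in> space (unitary_borel N)"
    then show "A * U \<in> carrier_mat N N"
      using assms unitary_mult unitary_group_carrier by auto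
  next
    fix k c assume kc: "k < N" "c < N"
    have "(\<lambda>U. \<Sum>l<N. A $$ (k, l) * U $$ (l, c)) \<in> borel_measurable (unitary_borel N)"
      using kc by measurable
    then show "(\<lambda>U. (A * U) $$ (k, c)) \<in> borel_measurable (unitary_borel N)"
      by (rule measurable_cong[THEN iffD1, rotated])
        (simp add: mat_mult_entry[OF unitary_group_carrier[OF assms] unitary_group_carrier _ kc(2)]
           kc(1) del: index_mult_mat(1))
  qed
qed

lemma haar_unitary_integral_mult:
  fixes F :: "complex mat \<Rightarrow> 'b::{banach, second_countable_topology}"
  assumes "haar_unitary N \<mu>" "A \<in> unitary_group N" "F \<in> borel_measurable (unitary_borel N)"
  shows "(\<integral>U. F (A * U) \<partial>\<mu>) = (\<integral>U. F U \<partial>\<mu>)"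
proof -
  note [measurable_cong] = haar_unitaryD(2)[OF assms(1)]
  have m: "(\<lambda>U. A * U) \<in> \<mu> \<rightarrow>\<^sub>M \<mu>"
    using measurable_unitary_mult[OF assms(2)] haar_unitaryD(2)[OF assms(1)]
    by (simp cong: measurable_cong_sets)
  have F: "F \<in> borel_measurable \<mu>"
    using assms(3) haar_unitaryD(2)[OF assms(1)] by (simp cong: measurable_cong_sets)
  have "(\<integral>U. F U \<partial>\<mu>) = (\<integral>U. F U \<partial>distr \<mu> \<mu> (\<lambda>U. A * U))"
    using assms(1,2) by (simp add: haar_unitary_def)
  also have "\<dots> = (\<integral>U. F (A * U) \<partial>\<mu>)"
    by (rule integral_distr[OF m F])
  finally show ?thesis ..
qed

text \<open>Dividing the derivative by \<i> makes \<open>G\<close> the action of the Hermitian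
  matrix \<open>w w\<^sup>*\<close> itself. The uniform bounds are recorded because they provide the
  domination for the limit under the integral and survive sums and products.\<close>

definition phase_deriv ::
    "nat \<Rightarrow> (nat \<Rightarrow> complex) \<Rightarrow> (complex mat \<Rightarrow> complex) \<Rightarrow> (complex mat \<Rightarrow> complex) \<Rightarrow> bool" where
  "phase_deriv N w F G \<longleftrightarrow>
     F \<in> borel_measurable (unitary_borel N) \<and> G \<in> borel_measurable (unitary_borel N) \<and>
     (\<exists>C. \<forall>U\<in>unitary_group N. cmod (F U) \<le> C \<and> cmod (G U) \<le> C) \<and>
     (\<forall>U\<in>unitary_group N.
        ((\<lambda>\<theta>. F (phase_mat N w \<theta> * U)) has_vector_derivative \<i> * G U) (at 0))"

text \<open>The definition differentiates at angle 0 only, but at every point of the group; the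
  one-parameter group property carries this to all other angles.\<close>

lemma phase_deriv_at:
  assumes "phase_deriv N w F G" "U \<in> unitary_group N"
  shows "((\<lambda>\<theta>. F (phase_mat N w \<theta> * U)) has_vector_derivative
           \<i> * G (phase_mat N w \<theta> * U)) (at \<theta>)"
proof -
  have U: "U \<in> carrier_mat N N" by (rule unitary_group_carrier[OF assms(2)])
  have "phase_mat N w \<theta> * U \<in> unitary_group N"
    by (rule unitary_mult[OF phase_mat_unitary assms(2)])
  with assms(1) have "((\<lambda>h. F (phase_mat N w h * (phase_mat N w \<theta> * U))) has_vector_derivative
           \<i> * G (phase_mat N w \<theta> * U)) (at (\<theta> - \<theta>))"
    by (simp add: phase_deriv_def)
  then have "((\<lambda>h. F (phase_mat N w (\<theta> + h) * U)) has_vector_derivative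
           \<i> * G (phase_mat N w \<theta> * U)) (at (\<theta> - \<theta>))"
    by (simp only: phase_mat_add_mult[OF U])
  moreover have "((\<lambda>t. t - \<theta>) has_vector_derivative 1) (at \<theta>)"
    by (auto intro!: derivative_eq_intros)
  ultimately show ?thesis
    using vector_diff_chain_at[of "\<lambda>t. t - \<theta>" 1 \<theta> "\<lambda>h. F (phase_mat N w (\<theta> + h) * U)"]
    by (simp add: o_def)
qed

text \<open>By left invariance every difference quotient of \<open>F\<close> along the flow has
  integral 0, and dominated convergence passes this on to the derivative.\<close>

lemma phase_deriv_integral:
  assumes haar: "haar_unitary N \<mu>" and "phase_deriv N w F G"
  shows "(\<integral>U. G U \<partial>\<mu>) = 0"
proof -
  interpret prob_space \<mu> by (rule haar_unitaryD[OF haar])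
  have F: "F \<in> borel_measurable (unitary_borel N)" and G: "G \<in> borel_measurable (unitary_borel N)"
    using assms(2) by (auto simp: phase_deriv_def)
  obtain C where C: "\<And>U. U \<in> unitary_group N \<Longrightarrow> cmod (F U) \<le> C"
      "\<And>U. U \<in> unitary_group N \<Longrightarrow> cmod (G U) \<le> C"
    using assms(2) unfolding phase_deriv_def by blast
  have mu_cong: "borel_measurable \<mu> = borel_measurable (unitary_borel N)"
    using haar_unitaryD(2)[OF haar] by (simp cong: measurable_cong_sets)
  define X where "X = (\<lambda>n U. real (Suc n) *\<^sub>R (F (phase_mat N w (1 / real (Suc n)) * U) - F U))"
  have Fm: "(\<lambda>U. F (phase_mat N w \<theta> * U)) \<in> borel_measurable (unitary_borel N)" for \<theta>
    by (rule measurable_compose[OF measurable_unitary_mult[OF phase_mat_unitary] F])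
  have Fint: "integrable \<mu> F"
    by (rule integrable_const_bound[where B = C])
      (use C F haar_unitaryD(3)[OF haar] in \<open>auto simp: mu_cong\<close>)
  have FRint: "integrable \<mu> (\<lambda>U. F (phase_mat N w \<theta> * U))" for \<theta>
    by (rule integrable_const_bound[where B = C])
      (use C Fm unitary_mult[OF phase_mat_unitary] haar_unitaryD(3)[OF haar] in \<open>auto simp: mu_cong\<close>)
  have "(\<lambda>n. \<integral>U. X n U \<partial>\<mu>) \<longlonglongrightarrow> (\<integral>U. \<i> * G U \<partial>\<mu>)"
  proof (rule integral_dominated_convergence[where w = "\<lambda>_. C"])
    show "(\<lambda>U. \<i> * G U) \<in> borel_measurable \<mu>" using G by (simp add: mu_cong)
    show "X n \<in> borel_measurable \<mu>" for n
      unfolding X_def mu_cong by (intro borel_measurable_scaleR borel_measurable_diff F Fm) simp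
    show "AE U in \<mu>. (\<lambda>n. X n U) \<longlonglongrightarrow> \<i> * G U"
    proof (rule AE_I2)
      fix U assume "U \<in> space \<mu>"
      then have U: "U \<in> unitary_group N" using haar_unitaryD(3)[OF haar] by simp
      have U0: "phase_mat N w 0 * U = U" by (rule phase_mat_0[OF unitary_group_carrier[OF U]])
      have "((\<lambda>\<theta>. F (phase_mat N w \<theta> * U)) has_vector_derivative \<i> * G U) (at 0)"
        using assms(2) U by (simp add: phase_deriv_def)
      then have "(\<lambda>h. cmod (F (phase_mat N w h * U) - F U - h *\<^sub>R (\<i> * G U)) / \<bar>h\<bar>) \<midarrow>0\<rightarrow> 0"
        by (simp add: has_vector_derivative_def has_derivative_at U0)
      moreover have "filterlim (\<lambda>n. 1 / real (Suc n)) (at 0) sequentially"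
        unfolding filterlim_at using lim_inverse_n'[THEN LIMSEQ_Suc] by simp
      ultimately have "(\<lambda>n. cmod (F (phase_mat N w (1 / real (Suc n)) * U) - F U
          - (1 / real (Suc n)) *\<^sub>R (\<i> * G U)) / \<bar>1 / real (Suc n)\<bar>) \<longlonglongrightarrow> 0"
        by (rule filterlim_compose)
      moreover have "cmod (F (phase_mat N w (1 / real (Suc n)) * U) - F U
          - (1 / real (Suc n)) *\<^sub>R (\<i> * G U)) / \<bar>1 / real (Suc n)\<bar> = cmod (X n U - \<i> * G U)" for n
      proof -
        have "X n U - \<i> * G U = real (Suc n) *\<^sub>R (F (phase_mat N w (1 / real (Suc n)) * U) - F U
          - (1 / real (Suc n)) *\<^sub>R (\<i> * G U))"
          unfolding X_def scaleR_diff_right scaleR_scaleR by simp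
        then show ?thesis by (simp only: norm_scaleR) (simp add: field_simps)
      qed
      ultimately have "(\<lambda>n. cmod (X n U - \<i> * G U)) \<longlonglongrightarrow> 0" by simp
      then have "(\<lambda>n. X n U - \<i> * G U) \<longlonglongrightarrow> 0" by (rule tendsto_norm_zero_cancel)
      then show "(\<lambda>n. X n U) \<longlonglongrightarrow> \<i> * G U" using LIM_zero_iff by blast
    qed
    show "AE U in \<mu>. norm (X n U) \<le> C" for n
    proof (rule AE_I2)
      fix U assume "U \<in> space \<mu>"
      then have U: "U \<in> unitary_group N" using haar_unitaryD(3)[OF haar] by simp
      have U0: "phase_mat N w 0 * U = U" by (rule phase_mat_0[OF unitary_group_carrier[OF U]])
      \<comment> \<open>The mean value inequality bounds the difference quotients uniformly in
        \<open>n\<close> and \<open>U\<close>. It uses the derivative along the whole orbit, not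
        only at angle 0.\<close>
      have "cmod (F (phase_mat N w (1 / real (Suc n)) * U) - F (phase_mat N w 0 * U))
          \<le> C * norm (1 / real (Suc n) - 0)"
      proof (rule differentiable_bound[of UNIV "\<lambda>\<theta>. F (phase_mat N w \<theta> * U)"])
        show "((\<lambda>\<theta>. F (phase_mat N w \<theta> * U)) has_derivative
           (\<lambda>x. x *\<^sub>R (\<i> * G (phase_mat N w \<theta> * U)))) (at \<theta> within UNIV)" for \<theta>
          using phase_deriv_at[OF assms(2) U] by (simp add: has_vector_derivative_def)
        show "onorm (\<lambda>x. x *\<^sub>R (\<i> * G (phase_mat N w \<theta> * U))) \<le> C" for \<theta>
          using C(2)[OF unitary_mult[OF phase_mat_unitary[of N w \<theta>] U]]
          by (intro onorm_le) (simp add: norm_mult mult.commute[of C] mult_left_mono)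
      qed auto
      then show "norm (X n U) \<le> C"
        unfolding X_def norm_scaleR by (simp add: U0 field_simps)
    qed
  qed simp
  moreover have "(\<integral>U. X n U \<partial>\<mu>) = 0" for n
    unfolding X_def
    using haar_unitary_integral_mult[OF haar phase_mat_unitary F] Fint FRint by simp
  ultimately have "(\<lambda>n::nat. 0::complex) \<longlonglongrightarrow> (\<integral>U. \<i> * G U \<partial>\<mu>)" by simp
  then have "(\<integral>U. \<i> * G U \<partial>\<mu>) = 0"
    using LIMSEQ_unique[OF tendsto_const] by metis
  then show ?thesis by simp
qed

section \<open>Rules for differentiation along the flows\<close>

lemma phase_deriv_const: "phase_deriv N w (\<lambda>U. c) (\<lambda>U. 0)"
  by (auto simp: phase_deriv_def)

lemma phase_deriv_add:
  assumes "phase_deriv N w F F'" "phase_deriv N w G G'"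
  shows "phase_deriv N w (\<lambda>U. F U + G U) (\<lambda>U. F' U + G' U)"
proof -
  obtain C D where "\<forall>U\<in>unitary_group N. cmod (F U) \<le> C \<and> cmod (F' U) \<le> C"
    "\<forall>U\<in>unitary_group N. cmod (G U) \<le> D \<and> cmod (G' U) \<le> D"
    using assms unfolding phase_deriv_def by blast
  then have "\<forall>U\<in>unitary_group N. cmod (F U + G U) \<le> C + D \<and> cmod (F' U + G' U) \<le> C + D"
    by (auto intro!: norm_triangle_mono)
  moreover have "((\<lambda>\<theta>. F (phase_mat N w \<theta> * U) + G (phase_mat N w \<theta> * U))
      has_vector_derivative \<i> * (F' U + G' U)) (at 0)" if "U \<in> unitary_group N" for U
    unfolding distrib_left
    by (rule has_vector_derivative_add) (use assms that in \<open>auto simp: phase_deriv_def\<close>)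
  ultimately show ?thesis
    using assms by (auto simp: phase_deriv_def)
qed

lemma phase_deriv_mult:
  assumes "phase_deriv N w F F'" "phase_deriv N w G G'"
  shows "phase_deriv N w (\<lambda>U. F U * G U) (\<lambda>U. F U * G' U + F' U * G U)"
proof -
  obtain C D where CD: "\<forall>U\<in>unitary_group N. cmod (F U) \<le> C \<and> cmod (F' U) \<le> C"
    "\<forall>U\<in>unitary_group N. cmod (G U) \<le> D \<and> cmod (G' U) \<le> D"
    using assms unfolding phase_deriv_def by blast
  have *: "cmod (a * b) \<le> C * D" if "cmod a \<le> C" "cmod b \<le> D" for a b
    using that by (auto simp: norm_mult intro!: mult_mono order_trans[OF norm_ge_zero])
  have **: "cmod (a * b) \<le> C * D + C * D" if "cmod a \<le> C" "cmod b \<le> D" for a b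
    using *[OF that] norm_ge_zero[of "a * b"] by linarith
  have "\<forall>U\<in>unitary_group N. cmod (F U * G U) \<le> C * D + C * D \<and>
      cmod (F U * G' U + F' U * G U) \<le> C * D + C * D"
    by (intro ballI conjI norm_triangle_mono * **) (use CD in auto)
  moreover have "((\<lambda>\<theta>. F (phase_mat N w \<theta> * U) * G (phase_mat N w \<theta> * U))
      has_vector_derivative \<i> * (F U * G' U + F' U * G U)) (at 0)" if U: "U \<in> unitary_group N" for U
  proof -
    have "((\<lambda>\<theta>. F (phase_mat N w \<theta> * U) * G (phase_mat N w \<theta> * U)) has_vector_derivative
       F (phase_mat N w 0 * U) * (\<i> * G' U) + (\<i> * F' U) * G (phase_mat N w 0 * U)) (at 0)"
      by (rule has_vector_derivative_mult) (use assms U in \<open>auto simp: phase_deriv_def\<close>)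
    then show ?thesis
      by (simp add: phase_mat_0[OF unitary_group_carrier[OF U]] algebra_simps)
  qed
  ultimately show ?thesis
    using assms by (auto simp: phase_deriv_def)
qed

text \<open>The sign comes from the factor \<i>: the conjugate of \<open>\<i> * F'\<close> is
  \<open>\<i> * (- cnj F')\<close>.\<close>

lemma phase_deriv_cnj:
  assumes "phase_deriv N w F F'"
  shows "phase_deriv N w (\<lambda>U. cnj (F U)) (\<lambda>U. - cnj (F' U))"
proof -
  have "((\<lambda>\<theta>. cnj (F (phase_mat N w \<theta> * U))) has_vector_derivative \<i> * (- cnj (F' U))) (at 0)"
    if "U \<in> unitary_group N" for U
    using has_vector_derivative_cnj[of "\<lambda>\<theta>. F (phase_mat N w \<theta> * U)" "\<i> * F' U"] assms that
    by (auto simp: phase_deriv_def)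
  moreover have "cnj \<in> borel_measurable borel"
    by (intro borel_measurable_continuous_onI continuous_intros)
  ultimately show ?thesis
    using assms by (auto simp: phase_deriv_def intro: measurable_compose[of _ _ borel cnj])
qed

lemma phase_deriv_entry:
  assumes "k < N" "c < N"
  shows "phase_deriv N w (\<lambda>U. U $$ (k, c)) (\<lambda>U. w k * (\<Sum>l<N. cnj (w l) * U $$ (l, c)))"
  unfolding phase_deriv_def
proof (intro conjI ballI)
  define B where "B = 1 + cmod (w k) * (\<Sum>l<N. cmod (w l))"
  have B: "1 \<le> B" by (auto simp: B_def intro!: mult_nonneg_nonneg sum_nonneg)
  have "cmod (w k * (\<Sum>l<N. cnj (w l) * U $$ (l, c))) \<le> B" if U: "U \<in> unitary_group N" for U
  proof -
    have "cmod (\<Sum>l<N. cnj (w l) * U $$ (l, c)) \<le> (\<Sum>l<N. cmod (w l))"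
      by (intro sum_norm_le)
        (use unitary_entry_bound[OF U _ assms(2)] in \<open>auto simp: norm_mult intro!: mult_left_le\<close>)
    then have "cmod (w k) * cmod (\<Sum>l<N. cnj (w l) * U $$ (l, c)) \<le> cmod (w k) * (\<Sum>l<N. cmod (w l))"
      by (intro mult_left_mono) auto
    then show ?thesis by (simp add: norm_mult B_def)
  qed
  then show "\<exists>C. \<forall>U\<in>unitary_group N. cmod (U $$ (k, c)) \<le> C \<and>
       cmod (w k * (\<Sum>l<N. cnj (w l) * U $$ (l, c))) \<le> C"
    using unitary_entry_bound[OF _ assms] B by (intro exI[of _ B]) force
  fix U assume U: "U \<in> unitary_group N"
  define S where "S = (\<Sum>l<N. cnj (w l) * U $$ (l, c))"
  have "((\<lambda>\<theta>. U $$ (k, c) + (phase_coeff N w \<theta> * w k) * S) has_vector_derivative \<i> * (w k * S)) (at 0)"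
    using has_vector_derivative_add[OF has_vector_derivative_const
        has_vector_derivative_mult_left[OF phase_coeff_deriv[OF assms(1), of w], of S], of "U $$ (k, c)"]
    by (simp add: mult.assoc)
  then show "((\<lambda>\<theta>. (phase_mat N w \<theta> * U) $$ (k, c)) has_vector_derivative \<i> * (w k * S)) (at 0)"
    by (simp add: phase_mat_mult_entry[OF unitary_group_carrier[OF U] assms] S_def mult.assoc phase_mat_0[OF unitary_group_carrier[OF U]]
        del: index_mult_mat(1))
qed (use assms in measurable)

text \<open>The derivation \<open>D\<^sub>a\<^sub>b\<close> sends the entries \<open>U\<^sub>b\<^sub>c\<close> to \<open>U\<^sub>a\<^sub>c\<close>, their conjugates \<open>cnj U\<^sub>a\<^sub>c\<close> to
  \<open>- cnj U\<^sub>b\<^sub>c\<close>, and all others to \<open>0\<close>; it is obtained by polarising the flows in the directions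
  \<open>e\<^sub>b + \<i>\<^sup>m e\<^sub>a\<close>.\<close>

definition unit_deriv ::
    "nat \<Rightarrow> nat \<Rightarrow> nat \<Rightarrow> (complex mat \<Rightarrow> complex) \<Rightarrow> (complex mat \<Rightarrow> complex) \<Rightarrow> bool" where
  "unit_deriv N a b F G \<longleftrightarrow>
     (\<exists>G'. (\<forall>m<4. phase_deriv N (\<lambda>k. of_bool (k = b) + \<i> ^ m * of_bool (k = a)) F (G' m)) \<and>
       G = (\<lambda>U. (\<Sum>m<4. \<i> ^ m * G' m U) / 4))"

lemma unit_deriv_integral:
  assumes haar: "haar_unitary N \<mu>" and "unit_deriv N a b F G"
  shows "integrable \<mu> G" "(\<integral>U. G U \<partial>\<mu>) = 0"
proof -
  interpret prob_space \<mu> by (rule haar_unitaryD[OF haar])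
  have mu_cong: "borel_measurable \<mu> = borel_measurable (unitary_borel N)"
    using haar_unitaryD(2)[OF haar] by (simp cong: measurable_cong_sets)
  obtain G' where G': "\<And>m. m < 4 \<Longrightarrow>
      phase_deriv N (\<lambda>k. of_bool (k = b) + \<i> ^ m * of_bool (k = a)) F (G' m)"
    and G: "G = (\<lambda>U. (\<Sum>m<4. \<i> ^ m * G' m U) / 4)"
    using assms(2) unfolding unit_deriv_def by blast
  have int: "integrable \<mu> (G' m)" if m: "m < 4" for m
  proof -
    obtain C where "\<forall>U\<in>unitary_group N. cmod (F U) \<le> C \<and> cmod (G' m U) \<le> C"
      using G'[OF m] unfolding phase_deriv_def by blast
    moreover have "G' m \<in> borel_measurable \<mu>"
      using G'[OF m] by (simp add: phase_deriv_def mu_cong)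
    ultimately show ?thesis
      by (intro integrable_const_bound[where B = C]) (auto simp: haar_unitaryD(3)[OF haar])
  qed
  show "integrable \<mu> G"
    unfolding G using int by (intro integrable_divide integrable_sum integrable_mult_right) auto
  have "(\<integral>U. G U \<partial>\<mu>) = (\<Sum>m<4. \<i> ^ m * (\<integral>U. G' m U \<partial>\<mu>)) / 4"
    unfolding G using int by (simp add: Bochner_Integration.integral_sum)
  then show "(\<integral>U. G U \<partial>\<mu>) = 0"
    using phase_deriv_integral[OF haar G'] by simp
qed

section \<open>Rules for the polarised derivations\<close>

lemma unit_deriv_cong: "unit_deriv N a b F G \<Longrightarrow> F = F' \<Longrightarrow> G = G' \<Longrightarrow> unit_deriv N a b F' G'"
  by simp

lemma unit_deriv_const: "unit_deriv N a b (\<lambda>U. c) (\<lambda>U. 0)"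
  unfolding unit_deriv_def by (intro exI[of _ "\<lambda>m U. 0"]) (auto intro: phase_deriv_const)

lemma unit_deriv_add:
  assumes "unit_deriv N a b F F'" "unit_deriv N a b G G'"
  shows "unit_deriv N a b (\<lambda>U. F U + G U) (\<lambda>U. F' U + G' U)"
proof -
  obtain f g where "\<forall>m<4. phase_deriv N (\<lambda>k. of_bool (k = b) + \<i> ^ m * of_bool (k = a)) F (f m)"
      and F': "F' = (\<lambda>U. (\<Sum>m<4. \<i> ^ m * f m U) / 4)"
      and "\<forall>m<4. phase_deriv N (\<lambda>k. of_bool (k = b) + \<i> ^ m * of_bool (k = a)) G (g m)"
      and G': "G' = (\<lambda>U. (\<Sum>m<4. \<i> ^ m * g m U) / 4)"
    using assms unfolding unit_deriv_def by blast
  then show ?thesis unfolding unit_deriv_def F' G'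
    by (intro exI[of _ "\<lambda>m U. f m U + g m U"])
      (auto intro: phase_deriv_add simp: fun_eq_iff sum.distrib distrib_left add_divide_distrib)
qed

lemma unit_deriv_mult:
  assumes "unit_deriv N a b F F'" "unit_deriv N a b G G'"
  shows "unit_deriv N a b (\<lambda>U. F U * G U) (\<lambda>U. F U * G' U + F' U * G U)"
proof -
  obtain f g where "\<forall>m<4. phase_deriv N (\<lambda>k. of_bool (k = b) + \<i> ^ m * of_bool (k = a)) F (f m)"
      and F': "F' = (\<lambda>U. (\<Sum>m<4. \<i> ^ m * f m U) / 4)"
      and "\<forall>m<4. phase_deriv N (\<lambda>k. of_bool (k = b) + \<i> ^ m * of_bool (k = a)) G (g m)"
      and G': "G' = (\<lambda>U. (\<Sum>m<4. \<i> ^ m * g m U) / 4)"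
    using assms unfolding unit_deriv_def by blast
  then show ?thesis unfolding unit_deriv_def F' G'
    by (intro exI[of _ "\<lambda>m U. F U * g m U + f m U * G U"] conjI allI impI phase_deriv_mult)
      (auto simp: fun_eq_iff sum.distrib algebra_simps add_divide_distrib sum_distrib_left)
qed

lemma cnj_of_bool [simp]: "cnj (of_bool P) = of_bool P"
  by (cases P) simp_all

lemma sum_of_bool_eq:
  fixes x :: "nat \<Rightarrow> complex"
  assumes "b < N"
  shows "(\<Sum>l<N. of_bool (l = b) * x l) = x b"
  using assms by (simp add: of_bool_def if_distribR if_distrib[of "\<lambda>x. x * _"] cong: if_cong)

text \<open>After expansion, the weight \<open>\<i> ^ m\<close> leaves exactly one of the four
  products free of \<open>m\<close>; the others carry the first or second power of
  \<open>\<i> ^ m\<close>, whose sums over the fourth roots of unity vanish.\<close>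

lemma polarisation:
  fixes x x' y y' :: complex
  shows "(\<Sum>m<4. \<i> ^ m * ((x + \<i> ^ m * x') * (y + cnj (\<i> ^ m) * y'))) / 4 = x * y'"
    and "(\<Sum>m<4. \<i> ^ m * ((x + cnj (\<i> ^ m) * x') * (y + \<i> ^ m * y'))) / 4 = x' * y"
  by (simp_all add: eval_nat_numeral algebra_simps)

lemma unit_deriv_entry:
  assumes "k < N" "c < N" "a < N" "b < N"
  shows "unit_deriv N a b (\<lambda>U. U $$ (k, c)) (\<lambda>U. of_bool (k = b) * U $$ (a, c))"
  unfolding unit_deriv_def
proof (intro exI conjI allI impI)
  let ?w = "\<lambda>m k. of_bool (k = b) + \<i> ^ m * of_bool (k = a)"
  show "phase_deriv N (?w m) (\<lambda>U. U $$ (k, c)) (\<lambda>U. ?w m k * (\<Sum>l<N. cnj (?w m l) * U $$ (l, c)))" for m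
    by (rule phase_deriv_entry[OF assms(1,2)])
  have "(\<Sum>l<N. cnj (?w m l) * U $$ (l, c)) = U $$ (b, c) + cnj (\<i> ^ m) * U $$ (a, c)" for U :: "complex mat" and m
    using assms by (simp add: distrib_right sum.distrib sum_distrib_left[symmetric] mult.assoc
        sum_of_bool_eq)
  then show "(\<lambda>U. of_bool (k = b) * U $$ (a, c)) =
      (\<lambda>U. (\<Sum>m<4. \<i> ^ m * (?w m k * (\<Sum>l<N. cnj (?w m l) * U $$ (l, c)))) / 4)"
    by (simp only: polarisation)
qed

lemma unit_deriv_cnj_entry:
  assumes "k < N" "c < N" "a < N" "b < N"
  shows "unit_deriv N a b (\<lambda>U. cnj (U $$ (k, c))) (\<lambda>U. - (of_bool (k = a) * cnj (U $$ (b, c))))"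
  unfolding unit_deriv_def
proof (intro exI conjI allI impI)
  let ?w = "\<lambda>m k. of_bool (k = b) + \<i> ^ m * of_bool (k = a)"
  show "phase_deriv N (?w m) (\<lambda>U. cnj (U $$ (k, c)))
      (\<lambda>U. - cnj (?w m k * (\<Sum>l<N. cnj (?w m l) * U $$ (l, c))))" for m
    by (rule phase_deriv_cnj[OF phase_deriv_entry[OF assms(1,2)]])
  have "(\<Sum>l<N. cnj (?w m l) * U $$ (l, c)) = U $$ (b, c) + cnj (\<i> ^ m) * U $$ (a, c)" for U :: "complex mat" and m
    using assms by (simp add: distrib_right sum.distrib sum_distrib_left[symmetric] mult.assoc
        sum_of_bool_eq)
  then have "- cnj (?w m k * (\<Sum>l<N. cnj (?w m l) * U $$ (l, c))) =
      - ((of_bool (k = b) + cnj (\<i> ^ m) * of_bool (k = a)) * (cnj (U $$ (b, c)) + \<i> ^ m * cnj (U $$ (a, c))))"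
    for U :: "complex mat" and m
    by simp
  then show "(\<lambda>U. - (of_bool (k = a) * cnj (U $$ (b, c)))) =
      (\<lambda>U. (\<Sum>m<4. \<i> ^ m * - cnj (?w m k * (\<Sum>l<N. cnj (?w m l) * U $$ (l, c)))) / 4)"
    by (simp only: mult_minus_right sum_negf minus_divide_left[symmetric] polarisation)
qed

lemma unit_deriv_cmult:
  assumes "unit_deriv N a b F F'"
  shows "unit_deriv N a b (\<lambda>U. c * F U) (\<lambda>U. c * F' U)"
  using unit_deriv_mult[OF unit_deriv_const assms, of c] by simp

lemma unit_deriv_diff:
  assumes "unit_deriv N a b F F'" "unit_deriv N a b G G'"
  shows "unit_deriv N a b (\<lambda>U. F U - G U) (\<lambda>U. F' U - G' U)"
  using unit_deriv_add[OF assms(1) unit_deriv_cmult[OF assms(2), of "-1"]] by simp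

lemma unit_deriv_sum:
  assumes "finite K" "\<And>k. k \<in> K \<Longrightarrow> unit_deriv N a b (F k) (F' k)"
  shows "unit_deriv N a b (\<lambda>U. \<Sum>k\<in>K. F k U) (\<lambda>U. \<Sum>k\<in>K. F' k U)"
  using assms
proof (induction K rule: finite_induct)
  case empty
  then show ?case using unit_deriv_const[of N a b 0] by simp
next
  case (insert k K)
  then show ?case using unit_deriv_add[of N a b "F k" "F' k"] by simp
qed

lemma unit_deriv_power:
  assumes "unit_deriv N a b F F'"
  shows "unit_deriv N a b (\<lambda>U. F U ^ n) (\<lambda>U. of_nat n * F U ^ (n - 1) * F' U)"
proof (induction n)
  case 0
  then show ?case using unit_deriv_const[of N a b 1] by simp
next
  case (Suc n)
  have "F U * (of_nat n * F U ^ (n - 1) * F' U) + F' U * F U ^ n = of_nat (Suc n) * F U ^ (Suc n - 1) * F' U"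
    for U
    \<comment> \<open>At \<open>n = 0\<close> the truncated exponent \<open>n - 1\<close> is
      multiplied by 0, hence the case split.\<close>
    by (cases n) (simp_all add: algebra_simps)
  then show ?case using unit_deriv_mult[OF assms Suc] by simp
qed

section \<open>The entries of \<open>U\<^sup>T * U\<close> and their derivatives\<close>

definition col_prod :: "nat \<Rightarrow> nat \<Rightarrow> nat \<Rightarrow> complex mat \<Rightarrow> complex" where
  "col_prod N i j U = (\<Sum>k<N. U $$ (k, i) * U $$ (k, j))"

lemma cnj_col_prod: "cnj (col_prod N i j U) = (\<Sum>k<N. cnj (U $$ (k, i)) * cnj (U $$ (k, j)))"
  by (simp add: col_prod_def cnj_sum)

lemma unit_deriv_col_prod:
  assumes "i < N" "j < N" "a < N" "b < N"
  shows "unit_deriv N a b (col_prod N i j)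
           (\<lambda>U. U $$ (b, i) * U $$ (a, j) + U $$ (a, i) * U $$ (b, j))"
proof -
  have "unit_deriv N a b (\<lambda>U. \<Sum>k<N. U $$ (k, i) * U $$ (k, j))
     (\<lambda>U. \<Sum>k<N. U $$ (k, i) * (of_bool (k = b) * U $$ (a, j)) + of_bool (k = b) * U $$ (a, i) * U $$ (k, j))"
    by (intro unit_deriv_sum unit_deriv_mult unit_deriv_entry) (use assms in auto)
  then show ?thesis
    by (rule unit_deriv_cong)
      (use assms in \<open>auto simp: col_prod_def fun_eq_iff sum.distrib of_bool_def if_distrib if_distribR
         cong: if_cong\<close>)
qed

lemma unit_deriv_cnj_col_prod:
  assumes "i < N" "j < N" "a < N" "b < N"
  shows "unit_deriv N a b (\<lambda>U. cnj (col_prod N i j U))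
           (\<lambda>U. - (cnj (U $$ (a, i)) * cnj (U $$ (b, j)) + cnj (U $$ (b, i)) * cnj (U $$ (a, j))))"
proof -
  have "unit_deriv N a b (\<lambda>U. \<Sum>k<N. cnj (U $$ (k, i)) * cnj (U $$ (k, j)))
     (\<lambda>U. \<Sum>k<N. cnj (U $$ (k, i)) * - (of_bool (k = a) * cnj (U $$ (b, j)))
        + - (of_bool (k = a) * cnj (U $$ (b, i))) * cnj (U $$ (k, j)))"
    by (intro unit_deriv_sum unit_deriv_mult unit_deriv_cnj_entry) (use assms in auto)
  then show ?thesis
    by (rule unit_deriv_cong)
      (use assms in \<open>auto simp: cnj_col_prod fun_eq_iff sum.distrib sum_negf of_bool_def if_distrib if_distribR
         cong: if_cong\<close>)
qed

section \<open>Moments of the entries\<close>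

lemma unitary_orthonormal':
  assumes "U \<in> unitary_group N" "c < N" "d < N"
  shows "(\<Sum>k<N. U $$ (k, c) * cnj (U $$ (k, d))) = of_bool (c = d)"
    and "(\<Sum>k<N. cnj (U $$ (k, c)) * U $$ (k, d)) = of_bool (c = d)"
  using unitary_orthonormal[OF assms(1,3,2)] unitary_orthonormal[OF assms]
  by (simp_all add: mult.commute)

text \<open>The equations satisfied by the mixed moments of \<open>P\<close>, \<open>Q\<close>, \<open>R\<close>: the vector field
  \<open>\<Sum> A\<^sub>a\<^sub>b D\<^sub>a\<^sub>b\<close> has divergence \<open>\<gamma>\<close>, maps \<open>P\<close> to \<open>\<alpha>\<close> and \<open>Q\<close> to \<open>\<beta>\<close>, and annihilates \<open>R\<close>.\<close>

lemma schwinger_dyson: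
  assumes haar: "haar_unitary N \<mu>"
    and dA: "\<And>a b. a < N \<Longrightarrow> b < N \<Longrightarrow> unit_deriv N a b (A a b) (A' a b)"
    and dP: "\<And>a b. a < N \<Longrightarrow> b < N \<Longrightarrow> unit_deriv N a b P (P' a b)"
    and dQ: "\<And>a b. a < N \<Longrightarrow> b < N \<Longrightarrow> unit_deriv N a b Q (Q' a b)"
    and dR: "\<And>a b. a < N \<Longrightarrow> b < N \<Longrightarrow> unit_deriv N a b R (R' a b)"
    and \<alpha>: "\<And>U. U \<in> unitary_group N \<Longrightarrow> (\<Sum>a<N. \<Sum>b<N. A a b U * P' a b U) = \<alpha> U"
    and \<beta>: "\<And>U. U \<in> unitary_group N \<Longrightarrow> (\<Sum>a<N. \<Sum>b<N. A a b U * Q' a b U) = \<beta> U"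
    and \<gamma>: "\<And>U. U \<in> unitary_group N \<Longrightarrow> (\<Sum>a<N. \<Sum>b<N. A' a b U) = \<gamma> U"
    and ann: "\<And>U. U \<in> unitary_group N \<Longrightarrow> (\<Sum>a<N. \<Sum>b<N. A a b U * R' a b U) = 0"
  shows "(\<integral>U. of_nat (Suc m) * P U ^ m * Q U ^ m * R U ^ k * \<alpha> U
      + of_nat m * P U ^ Suc m * Q U ^ (m - 1) * R U ^ k * \<beta> U
      + P U ^ Suc m * Q U ^ m * R U ^ k * \<gamma> U \<partial>\<mu>) = 0"
proof -
  \<comment> \<open>This is the derivative in the shape that the product rule produces. The one
    surplus factor \<open>P\<close> over \<open>Q\<close> balances phases: in the applications the
    coefficients \<open>A\<close> scale like \<open>cnj P\<close> when \<open>U\<close> is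
    multiplied by a phase.\<close>
  define G where "G = (\<lambda>a b U.
      A a b U * (P U ^ Suc m * (Q U ^ m * (of_nat k * R U ^ (k - 1) * R' a b U)
         + (of_nat m * Q U ^ (m - 1) * Q' a b U) * R U ^ k)
         + (of_nat (Suc m) * P U ^ (Suc m - 1) * P' a b U) * (Q U ^ m * R U ^ k))
      + A' a b U * (P U ^ Suc m * (Q U ^ m * R U ^ k)))"
  have G: "unit_deriv N a b (\<lambda>U. A a b U * (P U ^ Suc m * (Q U ^ m * R U ^ k))) (G a b)"
    if "a < N" "b < N" for a b
    unfolding G_def by (intro unit_deriv_mult unit_deriv_power dA dP dQ dR that)
  have "(\<integral>U. (\<Sum>a<N. \<Sum>b<N. G a b U) \<partial>\<mu>) = (\<Sum>a<N. \<Sum>b<N. (\<integral>U. G a b U \<partial>\<mu>))"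
    using unit_deriv_integral(1)[OF haar G]
    by (subst Bochner_Integration.integral_sum)
      (auto intro!: Bochner_Integration.integral_sum Bochner_Integration.integrable_sum sum.cong)
  also have "\<dots> = 0"
    using unit_deriv_integral(2)[OF haar G] by simp
  also have "(\<integral>U. (\<Sum>a<N. \<Sum>b<N. G a b U) \<partial>\<mu>) =
     (\<integral>U. of_nat (Suc m) * P U ^ m * Q U ^ m * R U ^ k * \<alpha> U
      + of_nat m * P U ^ Suc m * Q U ^ (m - 1) * R U ^ k * \<beta> U
      + P U ^ Suc m * Q U ^ m * R U ^ k * \<gamma> U \<partial>\<mu>)"
  proof (rule Bochner_Integration.integral_cong[OF refl])
    fix U assume "U \<in> space \<mu>"
    then have U: "U \<in> unitary_group N" using haar_unitaryD(3)[OF haar] by simp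
    have "G a b U = of_nat (Suc m) * P U ^ m * Q U ^ m * R U ^ k * (A a b U * P' a b U)
      + of_nat m * P U ^ Suc m * Q U ^ (m - 1) * R U ^ k * (A a b U * Q' a b U)
      + P U ^ Suc m * Q U ^ m * R U ^ k * A' a b U
      + P U ^ Suc m * Q U ^ m * of_nat k * R U ^ (k - 1) * (A a b U * R' a b U)" for a b
      by (simp add: G_def algebra_simps)
    then have "(\<Sum>a<N. \<Sum>b<N. G a b U) =
      of_nat (Suc m) * P U ^ m * Q U ^ m * R U ^ k * (\<Sum>a<N. \<Sum>b<N. A a b U * P' a b U)
      + of_nat m * P U ^ Suc m * Q U ^ (m - 1) * R U ^ k * (\<Sum>a<N. \<Sum>b<N. A a b U * Q' a b U)
      + P U ^ Suc m * Q U ^ m * R U ^ k * (\<Sum>a<N. \<Sum>b<N. A' a b U)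
      + P U ^ Suc m * Q U ^ m * of_nat k * R U ^ (k - 1) * (\<Sum>a<N. \<Sum>b<N. A a b U * R' a b U)"
      by (simp only: sum.distrib sum_distrib_left[symmetric])
    then show "(\<Sum>a<N. \<Sum>b<N. G a b U) = of_nat (Suc m) * P U ^ m * Q U ^ m * R U ^ k * \<alpha> U
      + of_nat m * P U ^ Suc m * Q U ^ (m - 1) * R U ^ k * \<beta> U
      + P U ^ Suc m * Q U ^ m * R U ^ k * \<gamma> U"
      by (simp only: \<alpha>[OF U] \<beta>[OF U] \<gamma>[OF U] ann[OF U]) simp
  qed
  finally show ?thesis .
qed

text \<open>Each term has as many factors \<open>p\<close> as \<open>cnj p\<close>, so only the
  modulus survives and the equation becomes a first-order recursion. The diagonal entry uses
  \<open>\<kappa> = 2\<close>, \<open>\<nu> = N + 1\<close>, \<open>e = 0\<close>; the off-diagonal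
  entry uses \<open>\<kappa> = 1\<close>, \<open>\<nu> = N - 1\<close>,
  \<open>e = 1\<close>.\<close>

lemma moment_form:
  fixes p r :: complex
  shows "of_nat (Suc m) * p ^ m * cnj p ^ m * r ^ k * (\<kappa> * r ^ e)
      + of_nat m * p ^ Suc m * cnj p ^ (m - 1) * r ^ k * (- \<kappa> * cnj p ^ 2)
      + p ^ Suc m * cnj p ^ m * r ^ k * (- \<nu> * cnj p)
    = \<kappa> * of_nat (Suc m) * (of_real ((cmod p)\<^sup>2) ^ m * r ^ (k + e))
      - (\<kappa> * of_nat m + \<nu>) * (of_real ((cmod p)\<^sup>2) ^ Suc m * r ^ k)"
proof -
  \<comment> \<open>The truncated \<open>m - 1\<close> is harmless at \<open>m = 0\<close>, where
    the factor \<open>of_nat m\<close> vanishes.\<close>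
  have 1: "of_nat m * p ^ Suc m * cnj p ^ (m - 1) * r ^ k * (- \<kappa> * cnj p ^ 2)
      = - (\<kappa> * of_nat m * (p * cnj p) ^ Suc m * r ^ k)"
    by (cases m) (simp_all add: power_mult_distrib power2_eq_square)
  show ?thesis
    unfolding 1 complex_norm_square by (simp add: power_mult_distrib power_add algebra_simps)
qed

lemma haar_integrable:
  assumes haar: "haar_unitary N \<mu>" and F: "F \<in> borel_measurable (unitary_borel N)"
    and C: "\<And>U. U \<in> unitary_group N \<Longrightarrow> norm (F U :: 'b::{banach, second_countable_topology}) \<le> C"
  shows "integrable \<mu> F"
proof -
  interpret prob_space \<mu> by (rule haar_unitaryD[OF haar])
  have mu_cong: "(borel_measurable \<mu> :: (_ \<Rightarrow> 'b) set) = borel_measurable (unitary_borel N)"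
    using haar_unitaryD(2)[OF haar] by (simp cong: measurable_cong_sets)
  show ?thesis
    by (rule integrable_const_bound[where B = C])
      (use C F haar_unitaryD(3)[OF haar] in \<open>auto simp: mu_cong\<close>)
qed

lemma measurable_col_prod [measurable]:
  "i < N \<Longrightarrow> j < N \<Longrightarrow> col_prod N i j \<in> borel_measurable (unitary_borel N)"
  unfolding col_prod_def[abs_def] by measurable

lemma col_prod_bound:
  assumes U: "U \<in> unitary_group N" and "i < N" "j < N"
  shows "cmod (col_prod N i j U) \<le> 1"
proof -
  have "cmod (col_prod N i j U) \<le> (\<Sum>k<N. cmod (U $$ (k, i)) * cmod (U $$ (k, j)))"
    unfolding col_prod_def by (rule order_trans[OF norm_sum]) (simp add: norm_mult)
  also have "\<dots> \<le> (\<Sum>k<N. ((cmod (U $$ (k, i)))\<^sup>2 + (cmod (U $$ (k, j)))\<^sup>2) / 2)"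
  proof (rule sum_mono)
    fix k
    show "cmod (U $$ (k, i)) * cmod (U $$ (k, j)) \<le> ((cmod (U $$ (k, i)))\<^sup>2 + (cmod (U $$ (k, j)))\<^sup>2) / 2"
      using sum_squares_bound[of "cmod (U $$ (k, i))" "cmod (U $$ (k, j))"] by simp
  qed
  also have "\<dots> = 1"
    using unitary_column_norm[OF U] assms(2,3) by (simp add: sum_divide_distrib[symmetric] sum.distrib)
  finally show ?thesis .
qed

lemma haar_integrable_moments:
  assumes haar: "haar_unitary N \<mu>" and ij: "i < N" "j < N" "i' < N" "j' < N"
  shows "integrable \<mu> (\<lambda>U. ((cmod (col_prod N i j U))\<^sup>2) ^ m * (1 - (cmod (col_prod N i' j' U))\<^sup>2) ^ k)"
proof (rule haar_integrable[OF haar, where C = 1])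
  show "(\<lambda>U. ((cmod (col_prod N i j U))\<^sup>2) ^ m * (1 - (cmod (col_prod N i' j' U))\<^sup>2) ^ k)
      \<in> borel_measurable (unitary_borel N)"
    using ij by measurable
  fix U assume U: "U \<in> unitary_group N"
  have "(cmod (col_prod N i j U))\<^sup>2 \<le> 1" "(cmod (col_prod N i' j' U))\<^sup>2 \<le> 1"
    using col_prod_bound[OF U] ij by (auto simp: power_le_one_iff)
  then show "norm (((cmod (col_prod N i j U))\<^sup>2) ^ m * (1 - (cmod (col_prod N i' j' U))\<^sup>2) ^ k) \<le> 1"
    by (auto simp: abs_mult power_abs intro!: mult_le_one power_le_one)
qed

text \<open>The field with coefficients \<open>cnj x_a * cnj x_b\<close> sends \<open>p\<close> to 2
  because \<open>x\<close> is a unit vector, and \<open>cnj p\<close> to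
  \<open>- 2 * cnj p ^ 2\<close>. In its divergence the diagonal \<open>a = b\<close> gives one
  \<open>- cnj p\<close>, and a sum whose terms do not depend on \<open>a\<close> gives
  \<open>N\<close> more.\<close>

lemma diagonal_moment_rec:
  assumes haar: "haar_unitary N \<mu>" and i: "i < N"
  shows "(real N + 1 + 2 * real m) * (\<integral>U. ((cmod (col_prod N i i U))\<^sup>2) ^ Suc m \<partial>\<mu>)
    = 2 * real (Suc m) * (\<integral>U. ((cmod (col_prod N i i U))\<^sup>2) ^ m \<partial>\<mu>)"
proof -
  define p where "p = col_prod N i i"
  \<comment> \<open>The powers of 1 spell out the instance \<open>R = 1\<close>,
    \<open>k = 0\<close>, \<open>e = 0\<close>, so that \<open>moment_form\<close> applies
    literally.\<close>
  have "(\<integral>U. of_nat (Suc m) * p U ^ m * cnj (p U) ^ m * 1 ^ 0 * (2 * 1 ^ 0)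
      + of_nat m * p U ^ Suc m * cnj (p U) ^ (m - 1) * 1 ^ 0 * (- 2 * cnj (p U) ^ 2)
      + p U ^ Suc m * cnj (p U) ^ m * 1 ^ 0 * (- (of_nat N + 1) * cnj (p U)) \<partial>\<mu>) = 0"
    unfolding p_def
  proof (rule schwinger_dyson[OF haar, where A = "\<lambda>a b U. cnj (U $$ (a, i)) * cnj (U $$ (b, i))"])
    fix a b assume ab: "a < N" "b < N"
    show "unit_deriv N a b (\<lambda>U. cnj (U $$ (a, i)) * cnj (U $$ (b, i)))
      (\<lambda>U. cnj (U $$ (a, i)) * - (of_bool (b = a) * cnj (U $$ (b, i)))
        + - (of_bool (a = a) * cnj (U $$ (b, i))) * cnj (U $$ (b, i)))"
      by (intro unit_deriv_mult unit_deriv_cnj_entry i ab)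
    show "unit_deriv N a b (col_prod N i i) (\<lambda>U. U $$ (b, i) * U $$ (a, i) + U $$ (a, i) * U $$ (b, i))"
      and "unit_deriv N a b (\<lambda>U. cnj (col_prod N i i U))
        (\<lambda>U. - (cnj (U $$ (a, i)) * cnj (U $$ (b, i)) + cnj (U $$ (b, i)) * cnj (U $$ (a, i))))"
      by (intro unit_deriv_col_prod unit_deriv_cnj_col_prod i ab)+
    show "unit_deriv N a b (\<lambda>U. 1) (\<lambda>U. 0)" by (rule unit_deriv_const)
  next
    fix U assume U: "U \<in> unitary_group N"
    define x where "x = (\<lambda>a. U $$ (a, i))"
    have x: "(\<Sum>a<N. cnj (x a) * x a) = 1"
      using unitary_orthonormal'(2)[OF U i i] by (simp add: x_def)
    have c: "cnj (col_prod N i i U) = (\<Sum>a<N. cnj (x a) * cnj (x a))"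
      by (simp add: cnj_col_prod x_def)
    have "(\<Sum>a<N. \<Sum>b<N. cnj (x a) * cnj (x b) * (x b * x a + x a * x b)) =
        2 * (\<Sum>a<N. \<Sum>b<N. (cnj (x a) * x a) * (cnj (x b) * x b))"
      unfolding sum_distrib_left by (intro sum.cong refl) (simp add: algebra_simps)
    also have "\<dots> = 2 * 1 ^ 0" by (simp add: sum_product[symmetric] x)
    finally show "(\<Sum>a<N. \<Sum>b<N. cnj (U $$ (a, i)) * cnj (U $$ (b, i)) *
        (U $$ (b, i) * U $$ (a, i) + U $$ (a, i) * U $$ (b, i))) = 2 * 1 ^ 0"
      by (simp only: x_def)
    have "(\<Sum>a<N. \<Sum>b<N. cnj (x a) * cnj (x b) * - (cnj (x a) * cnj (x b) + cnj (x b) * cnj (x a))) =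
        - 2 * (\<Sum>a<N. \<Sum>b<N. (cnj (x a) * cnj (x a)) * (cnj (x b) * cnj (x b)))"
      unfolding sum_distrib_left by (intro sum.cong refl) (simp add: algebra_simps)
    also have "\<dots> = - 2 * cnj (col_prod N i i U) ^ 2"
      by (simp add: sum_product[symmetric] c power2_eq_square)
    finally show "(\<Sum>a<N. \<Sum>b<N. cnj (U $$ (a, i)) * cnj (U $$ (b, i)) *
        - (cnj (U $$ (a, i)) * cnj (U $$ (b, i)) + cnj (U $$ (b, i)) * cnj (U $$ (a, i))))
        = - 2 * cnj (col_prod N i i U) ^ 2"
      by (simp only: x_def)
    have "(\<Sum>a<N. \<Sum>b<N. cnj (x a) * - (of_bool (b = a) * cnj (x b)) + - (of_bool (a = a) * cnj (x b)) * cnj (x b))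
      = - (\<Sum>a<N. \<Sum>b<N. of_bool (b = a) * (cnj (x a) * cnj (x b))) - (\<Sum>a<N. \<Sum>b<N. cnj (x b) * cnj (x b))"
      unfolding sum_negf[symmetric] sum_subtractf[symmetric] by (intro sum.cong refl) (simp add: algebra_simps)
    also have "(\<Sum>a<N. \<Sum>b<N. of_bool (b = a) * (cnj (x a) * cnj (x b))) = cnj (col_prod N i i U)"
      unfolding c by (intro sum.cong refl sum_of_bool_eq) simp
    finally show "(\<Sum>a<N. \<Sum>b<N. cnj (U $$ (a, i)) * - (of_bool (b = a) * cnj (U $$ (b, i)))
        + - (of_bool (a = a) * cnj (U $$ (b, i))) * cnj (U $$ (b, i)))
        = - (of_nat N + 1) * cnj (col_prod N i i U)"
      unfolding c[symmetric] by (simp add: x_def algebra_simps cnj_col_prod)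
  qed simp
  then have "(\<integral>U. 2 * of_nat (Suc m) * (of_real ((cmod (p U))\<^sup>2) ^ m * 1 ^ (0 + 0))
      - (2 * of_nat m + (of_nat N + 1)) * (of_real ((cmod (p U))\<^sup>2) ^ Suc m * 1 ^ 0) \<partial>\<mu>) = (0 :: complex)"
    unfolding moment_form .
  also have "(\<integral>U. 2 * of_nat (Suc m) * (of_real ((cmod (p U))\<^sup>2) ^ m * 1 ^ (0 + 0))
      - (2 * of_nat m + (of_nat N + 1)) * (of_real ((cmod (p U))\<^sup>2) ^ Suc m * 1 ^ 0) \<partial>\<mu>) =
    (\<integral>U. complex_of_real (2 * real (Suc m) * ((cmod (p U))\<^sup>2) ^ m
      - (2 * real m + (real N + 1)) * ((cmod (p U))\<^sup>2) ^ Suc m) \<partial>\<mu>)"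
    by simp
  finally have "(\<integral>U. 2 * real (Suc m) * ((cmod (p U))\<^sup>2) ^ m
      - (2 * real m + (real N + 1)) * ((cmod (p U))\<^sup>2) ^ Suc m \<partial>\<mu>) = 0"
    unfolding integral_complex_of_real by (simp only: of_real_eq_0_iff)
  moreover have "integrable \<mu> (\<lambda>U. ((cmod (p U))\<^sup>2) ^ k)" for k
    using haar_integrable_moments[OF haar i i i i, of k 0] by (simp add: p_def)
  ultimately have "2 * real (Suc m) * (\<integral>U. ((cmod (p U))\<^sup>2) ^ m \<partial>\<mu>)
      - (2 * real m + (real N + 1)) * (\<integral>U. ((cmod (p U))\<^sup>2) ^ Suc m \<partial>\<mu>) = 0"
    by (simp only: Bochner_Integration.integral_diff integrable_mult_right integral_mult_right_zero)
  then show ?thesis unfolding p_def by (simp only: diff_eq_eq) (simp only: ac_simps)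
qed


text \<open>With \<open>u_a = cnj x_a - cnj p * x_a\<close>, the field \<open>u_a * cnj y_b\<close>
  sends \<open>v\<close> to \<open>R = 1 - |p|^2\<close> and \<open>cnj v\<close> to
  \<open>- cnj v ^ 2\<close>. It does move the column \<open>x\<close>, namely to
  \<open>R * cnj y\<close>, but it annihilates \<open>p\<close> since \<open>x\<close> and
  \<open>y\<close> are orthogonal, and \<open>cnj p\<close> since \<open>u\<close> and
  \<open>x\<close> are. Hence \<open>R\<close> is a constant for it, and one power of
  \<open>|v|^2\<close> is exchanged for one power of \<open>R\<close>.\<close>

lemma off_diagonal_moment_rec:
  assumes haar: "haar_unitary N \<mu>" and ij: "i < N" "j < N" "i \<noteq> j"
  shows "(real N - 1 + real m) *
      (\<integral>U. ((cmod (col_prod N i j U))\<^sup>2) ^ Suc m * (1 - (cmod (col_prod N i i U))\<^sup>2) ^ k \<partial>\<mu>)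
    = real (Suc m) *
      (\<integral>U. ((cmod (col_prod N i j U))\<^sup>2) ^ m * (1 - (cmod (col_prod N i i U))\<^sup>2) ^ Suc k \<partial>\<mu>)"
proof -
  define p where "p = col_prod N i i"
  define v where "v = col_prod N i j"
  define R where "R = (\<lambda>U. 1 - p U * cnj (p U))"
  have "(\<integral>U. of_nat (Suc m) * v U ^ m * cnj (v U) ^ m * R U ^ k * (1 * R U ^ 1)
      + of_nat m * v U ^ Suc m * cnj (v U) ^ (m - 1) * R U ^ k * (- 1 * cnj (v U) ^ 2)
      + v U ^ Suc m * cnj (v U) ^ m * R U ^ k * (- (of_nat N - 1) * cnj (v U)) \<partial>\<mu>) = 0"
  proof (rule schwinger_dyson[OF haar,
      where A = "\<lambda>a b U. (cnj (U $$ (a, i)) - cnj (p U) * U $$ (a, i)) * cnj (U $$ (b, j))"])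
    fix a b assume ab: "a < N" "b < N"
    have dp: "unit_deriv N a b p (\<lambda>U. U $$ (b, i) * U $$ (a, i) + U $$ (a, i) * U $$ (b, i))"
      and dcp: "unit_deriv N a b (\<lambda>U. cnj (p U))
        (\<lambda>U. - (cnj (U $$ (a, i)) * cnj (U $$ (b, i)) + cnj (U $$ (b, i)) * cnj (U $$ (a, i))))"
      unfolding p_def by (intro unit_deriv_col_prod unit_deriv_cnj_col_prod ij ab)+
    show "unit_deriv N a b v (\<lambda>U. U $$ (b, i) * U $$ (a, j) + U $$ (a, i) * U $$ (b, j))"
      and "unit_deriv N a b (\<lambda>U. cnj (v U))
        (\<lambda>U. - (cnj (U $$ (a, i)) * cnj (U $$ (b, j)) + cnj (U $$ (b, i)) * cnj (U $$ (a, j))))"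
      unfolding v_def by (intro unit_deriv_col_prod unit_deriv_cnj_col_prod ij ab)+
    show "unit_deriv N a b (\<lambda>U. (cnj (U $$ (a, i)) - cnj (p U) * U $$ (a, i)) * cnj (U $$ (b, j)))
      (\<lambda>U. (cnj (U $$ (a, i)) - cnj (p U) * U $$ (a, i)) * - (of_bool (b = a) * cnj (U $$ (b, j)))
        + (- (of_bool (a = a) * cnj (U $$ (b, i))) - (cnj (p U) * (of_bool (a = b) * U $$ (a, i))
           + - (cnj (U $$ (a, i)) * cnj (U $$ (b, i)) + cnj (U $$ (b, i)) * cnj (U $$ (a, i))) * U $$ (a, i)))
          * cnj (U $$ (b, j)))"
      by (intro unit_deriv_mult unit_deriv_diff unit_deriv_entry unit_deriv_cnj_entry dcp ij ab)
    show "unit_deriv N a b R (\<lambda>U. 0 -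
        (p U * - (cnj (U $$ (a, i)) * cnj (U $$ (b, i)) + cnj (U $$ (b, i)) * cnj (U $$ (a, i)))
         + (U $$ (b, i) * U $$ (a, i) + U $$ (a, i) * U $$ (b, i)) * cnj (p U)))"
      unfolding R_def by (intro unit_deriv_mult unit_deriv_diff unit_deriv_const dp dcp)
  next
    fix U assume U: "U \<in> unitary_group N"
    define x where "x = (\<lambda>a. U $$ (a, i))"
    define y where "y = (\<lambda>a. U $$ (a, j))"
    define u where "u = (\<lambda>a. cnj (x a) - cnj (p U) * x a)"
    have o: "(\<Sum>a<N. x a * cnj (x a)) = 1" "(\<Sum>a<N. y a * cnj (y a)) = 1"
      "(\<Sum>a<N. x a * cnj (y a)) = 0" "(\<Sum>a<N. y a * cnj (x a)) = 0"
      using unitary_orthonormal'(1)[OF U] ij by (auto simp: x_def y_def)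
    have c: "(\<Sum>a<N. x a * x a) = p U" "(\<Sum>a<N. cnj (x a) * cnj (x a)) = cnj (p U)"
       "(\<Sum>a<N. x a * y a) = v U" "(\<Sum>a<N. cnj (x a) * cnj (y a)) = cnj (v U)"
      unfolding p_def v_def cnj_col_prod by (auto simp: x_def y_def col_prod_def)
    have u: "(\<Sum>a<N. u a * x a) = R U" "(\<Sum>a<N. u a * cnj (x a)) = 0"
       "(\<Sum>a<N. u a * cnj (y a)) = cnj (v U)"
      unfolding u_def left_diff_distrib sum_subtractf mult.assoc sum_distrib_left[symmetric] o c
      using o c by (simp_all add: R_def mult.commute)
    have "(\<Sum>a<N. \<Sum>b<N. u a * cnj (y b) * (x b * y a + x a * y b)) =
        (\<Sum>a<N. \<Sum>b<N. (u a * y a) * (x b * cnj (y b))) + (\<Sum>a<N. \<Sum>b<N. (u a * x a) * (y b * cnj (y b)))"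
      unfolding sum.distrib[symmetric] by (intro sum.cong refl) (simp add: algebra_simps)
    also have "\<dots> = 1 * R U ^ 1"
      by (simp add: sum_product[symmetric] o u)
    finally show "(\<Sum>a<N. \<Sum>b<N. (cnj (U $$ (a, i)) - cnj (p U) * U $$ (a, i)) * cnj (U $$ (b, j)) *
        (U $$ (b, i) * U $$ (a, j) + U $$ (a, i) * U $$ (b, j))) = 1 * R U ^ 1"
      by (simp only: x_def y_def u_def)
    have "(\<Sum>a<N. \<Sum>b<N. u a * cnj (y b) * - (cnj (x a) * cnj (y b) + cnj (x b) * cnj (y a))) =
        - ((\<Sum>a<N. \<Sum>b<N. (u a * cnj (x a)) * (cnj (y b) * cnj (y b)))
           + (\<Sum>a<N. \<Sum>b<N. (u a * cnj (y a)) * (cnj (x b) * cnj (y b))))"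
      unfolding sum.distrib[symmetric] sum_negf[symmetric] by (intro sum.cong refl) (simp add: algebra_simps)
    also have "\<dots> = - 1 * cnj (v U) ^ 2"
      by (simp add: sum_product[symmetric] c u power2_eq_square)
    finally show "(\<Sum>a<N. \<Sum>b<N. (cnj (U $$ (a, i)) - cnj (p U) * U $$ (a, i)) * cnj (U $$ (b, j)) *
        - (cnj (U $$ (a, i)) * cnj (U $$ (b, j)) + cnj (U $$ (b, i)) * cnj (U $$ (a, j))))
        = - 1 * cnj (v U) ^ 2"
      by (simp only: x_def y_def u_def)
    \<comment> \<open>The divergence: the first two sums give \<open>- (N + 1) * cnj v\<close>, the
      third vanishes by orthogonality of the columns, and the fourth, which comes from
      differentiating the correction term \<open>cnj p\<close>, adds
      \<open>2 * cnj v\<close>.\<close>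
    have "(\<Sum>a<N. \<Sum>b<N. u a * - (of_bool (b = a) * cnj (y b))
        + (- (of_bool (a = a) * cnj (x b)) - (cnj (p U) * (of_bool (a = b) * x a)
           + - (cnj (x a) * cnj (x b) + cnj (x b) * cnj (x a)) * x a)) * cnj (y b))
      = - (\<Sum>a<N. \<Sum>b<N. of_bool (b = a) * (u a * cnj (y b))) - (\<Sum>a<N. \<Sum>b<N. cnj (x b) * cnj (y b))
        - cnj (p U) * (\<Sum>a<N. \<Sum>b<N. of_bool (b = a) * (x a * cnj (y b)))
        + 2 * (\<Sum>a<N. \<Sum>b<N. (x a * cnj (x a)) * (cnj (x b) * cnj (y b)))"
      unfolding sum.distrib[symmetric] sum_negf[symmetric] sum_distrib_left sum_subtractf[symmetric]
      by (intro sum.cong refl) (simp add: algebra_simps eq_commute[of a b for a b :: nat])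
    also have "\<dots> = - (of_nat N - 1) * cnj (v U)"
    proof -
      have "(\<Sum>a<N. \<Sum>b<N. of_bool (b = a) * (u a * cnj (y b))) = (\<Sum>a<N. u a * cnj (y a))"
        "(\<Sum>a<N. \<Sum>b<N. of_bool (b = a) * (x a * cnj (y b))) = (\<Sum>a<N. x a * cnj (y a))"
        by (intro sum.cong refl sum_of_bool_eq, simp)+
      then show ?thesis
        by (simp add: sum_product[symmetric] o c u) (simp add: algebra_simps)
    qed
    finally show "(\<Sum>a<N. \<Sum>b<N. (cnj (U $$ (a, i)) - cnj (p U) * U $$ (a, i)) * - (of_bool (b = a) * cnj (U $$ (b, j)))
        + (- (of_bool (a = a) * cnj (U $$ (b, i))) - (cnj (p U) * (of_bool (a = b) * U $$ (a, i))
           + - (cnj (U $$ (a, i)) * cnj (U $$ (b, i)) + cnj (U $$ (b, i)) * cnj (U $$ (a, i))) * U $$ (a, i)))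
          * cnj (U $$ (b, j))) = - (of_nat N - 1) * cnj (v U)"
      by (simp only: x_def y_def u_def)
    have "(\<Sum>a<N. \<Sum>b<N. u a * cnj (y b) * (0 -
        (p U * - (cnj (x a) * cnj (x b) + cnj (x b) * cnj (x a)) + (x b * x a + x a * x b) * cnj (p U)))) =
        2 * p U * (\<Sum>a<N. \<Sum>b<N. (u a * cnj (x a)) * (cnj (x b) * cnj (y b)))
        - 2 * cnj (p U) * (\<Sum>a<N. \<Sum>b<N. (u a * x a) * (x b * cnj (y b)))"
      unfolding sum_distrib_left sum_subtractf[symmetric] by (intro sum.cong refl) (simp add: algebra_simps)
    also have "\<dots> = 0"
      by (simp add: sum_product[symmetric] o u)
    finally show "(\<Sum>a<N. \<Sum>b<N. (cnj (U $$ (a, i)) - cnj (p U) * U $$ (a, i)) * cnj (U $$ (b, j)) * (0 -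
        (p U * - (cnj (U $$ (a, i)) * cnj (U $$ (b, i)) + cnj (U $$ (b, i)) * cnj (U $$ (a, i)))
         + (U $$ (b, i) * U $$ (a, i) + U $$ (a, i) * U $$ (b, i)) * cnj (p U)))) = 0"
      by (simp only: x_def y_def u_def)
  qed
  then have "(\<integral>U. 1 * of_nat (Suc m) * (of_real ((cmod (v U))\<^sup>2) ^ m * R U ^ (k + 1))
      - (1 * of_nat m + (of_nat N - 1)) * (of_real ((cmod (v U))\<^sup>2) ^ Suc m * R U ^ k) \<partial>\<mu>) = (0 :: complex)"
    unfolding moment_form .
  moreover have "R U = of_real (1 - (cmod (p U))\<^sup>2)" for U
    by (simp add: R_def complex_norm_square del: of_real_power)
  ultimately have "(\<integral>U. complex_of_real (real (Suc m) * (((cmod (v U))\<^sup>2) ^ m * (1 - (cmod (p U))\<^sup>2) ^ Suc k)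
      - (real m + (real N - 1)) * (((cmod (v U))\<^sup>2) ^ Suc m * (1 - (cmod (p U))\<^sup>2) ^ k)) \<partial>\<mu>) = 0"
    by simp
  then have "(\<integral>U. real (Suc m) * (((cmod (v U))\<^sup>2) ^ m * (1 - (cmod (p U))\<^sup>2) ^ Suc k)
      - (real m + (real N - 1)) * (((cmod (v U))\<^sup>2) ^ Suc m * (1 - (cmod (p U))\<^sup>2) ^ k) \<partial>\<mu>) = 0"
    unfolding integral_complex_of_real by (simp only: of_real_eq_0_iff)
  moreover have "integrable \<mu> (\<lambda>U. ((cmod (v U))\<^sup>2) ^ m * (1 - (cmod (p U))\<^sup>2) ^ k)" for m k
    using haar_integrable_moments[OF haar ij(1,2) ij(1,1), of m k] by (simp add: p_def v_def)
  ultimately have "real (Suc m) * (\<integral>U. ((cmod (v U))\<^sup>2) ^ m * (1 - (cmod (p U))\<^sup>2) ^ Suc k \<partial>\<mu>)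
      - (real m + (real N - 1)) * (\<integral>U. ((cmod (v U))\<^sup>2) ^ Suc m * (1 - (cmod (p U))\<^sup>2) ^ k \<partial>\<mu>) = 0"
    by (simp only: Bochner_Integration.integral_diff integrable_mult_right integral_mult_right_zero)
  then show ?thesis unfolding p_def v_def by (simp only: diff_eq_eq) (simp only: ac_simps)
qed

section \<open>Laws of bounded and of rotation invariant variables\<close>

abbreviation unif01 :: "real measure" where
  "unif01 \<equiv> restrict_space lborel {0<..<1}"

lemma prob_space_unif01: "prob_space unif01"
  by (rule prob_spaceI) (simp add: space_restrict_space emeasure_restrict_space)

text \<open>Differentiability is asked for in the interior only, as it will be applied to powers
  \<open>t powr a\<close>, which for \<open>a < 1\<close> are not differentiable at 0.\<close>

lemma unif01_integral_FTC:
  fixes F F' :: "real \<Rightarrow> real"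
  assumes "continuous_on {0..1} F" "\<And>t. 0 < t \<Longrightarrow> t < 1 \<Longrightarrow> (F has_real_derivative F' t) (at t)"
    and "F' \<in> borel_measurable borel" "\<And>t. 0 < t \<Longrightarrow> t < 1 \<Longrightarrow> \<bar>F' t\<bar> \<le> B"
  shows "(\<integral>t. F' t \<partial>unif01) = F 1 - F 0" "integrable unif01 F'"
proof -
  interpret prob_space unif01 by (rule prob_space_unif01)
  show int: "integrable unif01 F'"
    by (rule integrable_const_bound[where B = B])
      (use assms(3,4) in \<open>auto simp: space_restrict_space intro!: measurable_restrict_space1\<close>)
  then have set_int: "set_integrable lborel {0<..<1} F'"
    by (subst (asm) integrable_restrict_space) (auto simp: set_integrable_def)
  have "(F' has_integral F 1 - F 0) {0..1}"
    by (rule fundamental_theorem_of_calculus_interior)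
      (use assms(1,2) in \<open>auto simp: has_real_derivative_iff_has_vector_derivative\<close>)
  then have "(F' has_integral F 1 - F 0) {0<..<1}"
    by (simp add: has_integral_Icc_iff_Ioo)
  then have "(LINT t:{0<..<1}|lborel. F' t) = F 1 - F 0"
    using set_borel_integral_eq_integral(2)[OF set_int] by (simp add: integral_unique)
  then show "(\<integral>t. F' t \<partial>unif01) = F 1 - F 0"
    by (subst integral_restrict_space) (auto simp: set_lebesgue_integral_def)
qed

section \<open>Moments of powers of a uniform variable\<close>

lemma one_minus_powr_bounds:
  assumes "a \<ge> 0" "0 < t" "t < (1::real)"
  shows "0 \<le> 1 - t powr a" "1 - t powr a \<le> 1"
  using assms powr_mono2[of a t 1] by auto

text \<open>The function \<open>t * (1 - t powr a) ^ Suc m\<close> vanishes at both ends of the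
  interval, so its derivative integrates to 0.\<close>

lemma unif01_one_minus_powr_rec:
  assumes "a > 0"
  shows "(1 + real (Suc m) * a) * (\<integral>t. (1 - t powr a) ^ Suc m \<partial>unif01)
    = real (Suc m) * a * (\<integral>t. (1 - t powr a) ^ m \<partial>unif01)"
proof -
  interpret prob_space unif01 by (rule prob_space_unif01)
  define F where "F = (\<lambda>t::real. t * (1 - t powr a) ^ Suc m)"
  define F' where "F' = (\<lambda>t::real. (1 + real (Suc m) * a) * (1 - t powr a) ^ Suc m
      - real (Suc m) * a * (1 - t powr a) ^ m)"
  have bd: "\<bar>(1 - t powr a) ^ n\<bar> \<le> 1" if "0 < t" "t < 1" for t and n
    using one_minus_powr_bounds[of a t] assms that by (auto intro!: power_le_one simp: power_abs)
  have int: "integrable unif01 (\<lambda>t. (1 - t powr a) ^ n)" for n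
    by (rule integrable_const_bound[where B = 1])
      (use bd in \<open>auto simp: space_restrict_space intro!: measurable_restrict_space1\<close>)
  have "(\<integral>t. F' t \<partial>unif01) = F 1 - F 0"
  proof (rule unif01_integral_FTC(1)[where B = "(1 + real (Suc m) * a) + real (Suc m) * a"])
    show "continuous_on {0..1} F"
      unfolding F_def using assms
      by (intro continuous_on_mult continuous_on_power continuous_on_diff continuous_on_powr'
          continuous_on_const continuous_on_id) auto
    show "F' \<in> borel_measurable borel" unfolding F'_def by measurable
    fix t :: real assume t: "0 < t" "t < 1"
    have "t * (a * t powr (a - 1)) = a * t powr a"
      using t by (simp add: powr_diff)
    moreover have "((\<lambda>t. 1 - t powr a) has_real_derivative - (a * t powr (a - 1))) (at t)"
      using t by (auto intro!: derivative_eq_intros)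
    from DERIV_mult[OF DERIV_ident DERIV_power[OF this, of "Suc m"]]
    have "(F has_real_derivative (1 - t powr a) ^ Suc m
        - real (Suc m) * (1 - t powr a) ^ m * (t * (a * t powr (a - 1)))) (at t)"
      unfolding F_def by (rule DERIV_cong) (simp del: power_Suc of_nat_Suc)
    ultimately have *: "(F has_real_derivative (1 - t powr a) ^ Suc m
        - real (Suc m) * (1 - t powr a) ^ m * (a * t powr a)) (at t)"
      by (simp only:)
    \<comment> \<open>Taking \<open>x = 1 - t powr a\<close> expresses the leftover factor
      \<open>t powr a\<close> as \<open>1 - x\<close>, which closes the recursion.\<close>
    have "c * x ^ m * (a * (1 - x)) = c * a * x ^ m - c * a * x ^ Suc m" for c x :: real
      by (simp add: algebra_simps)
    from this[of "real (Suc m)" "1 - t powr a"]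
    have "(1 - t powr a) ^ Suc m - real (Suc m) * (1 - t powr a) ^ m * (a * t powr a) = F' t"
      unfolding F'_def by (simp add: distrib_right del: power_Suc of_nat_Suc)
    with * show "(F has_real_derivative F' t) (at t)" by (simp only:)
    have "\<bar>F' t\<bar> \<le> \<bar>(1 + real (Suc m) * a) * (1 - t powr a) ^ Suc m\<bar> + \<bar>real (Suc m) * a * (1 - t powr a) ^ m\<bar>"
      unfolding F'_def by (rule abs_triangle_ineq4)
    also have "\<dots> \<le> (1 + real (Suc m) * a) + real (Suc m) * a"
      unfolding abs_mult[of "1 + real (Suc m) * a"] abs_mult[of "real (Suc m) * a"]
      using assms by (intro add_mono order_trans[OF mult_left_mono[OF bd[OF t]]]) auto
    finally show "\<bar>F' t\<bar> \<le> (1 + real (Suc m) * a) + real (Suc m) * a" .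
  qed
  moreover have "F 1 - F 0 = 0" using assms by (simp add: F_def)
  ultimately show ?thesis
    unfolding F'_def using int
    by (simp only: Bochner_Integration.integral_diff integrable_mult_right integral_mult_right_zero)
qed

text \<open>Equal moments give equal integrals of polynomials, and on the compact interval these
  approximate \<open>g\<close> uniformly.\<close>

lemma moments_determine_integral:
  fixes X :: "'a \<Rightarrow> real" and Y :: "'b \<Rightarrow> real" and g :: "real \<Rightarrow> real"
  assumes "prob_space M" "prob_space Q"
    and [measurable]: "X \<in> borel_measurable M" "Y \<in> borel_measurable Q"
    and X: "\<And>x. x \<in> space M \<Longrightarrow> X x \<in> {0..1}" and Y: "\<And>y. y \<in> space Q \<Longrightarrow> Y y \<in> {0..1}"
    and moments: "\<And>n. (\<integral>x. X x ^ n \<partial>M) = (\<integral>y. Y y ^ n \<partial>Q)"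
    and g: "continuous_on UNIV g"
  shows "(\<integral>x. g (X x) \<partial>M) = (\<integral>y. g (Y y) \<partial>Q)"
proof -
  interpret M: prob_space M by fact
  interpret Q: prob_space Q by fact
  have [measurable]: "g \<in> borel_measurable borel"
    using g by (rule borel_measurable_continuous_onI)
  have "bounded (g ` {0..1})"
    by (rule compact_imp_bounded[OF compact_continuous_image])
      (use g continuous_on_subset in auto)
  then obtain B where "\<forall>t\<in>{0..1}. \<bar>g t\<bar> \<le> B"
    by (auto simp: bounded_iff)
  then have B: "\<bar>g t\<bar> \<le> B" if "t \<in> {0..1}" for t using that by blast
  have pow: "\<bar>t ^ n\<bar> \<le> 1" if "t \<in> {0..1}" for t :: real and n
    using that by (auto simp: power_abs intro!: power_le_one)
  have intX: "integrable M (\<lambda>x. X x ^ n)" for n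
  proof (rule M.integrable_const_bound[where B = 1])
    show "AE x in M. norm (X x ^ n) \<le> 1"
      by (intro AE_I2) (simp only: real_norm_def pow X)
  qed measurable
  have intgX: "integrable M (\<lambda>x. g (X x))"
  proof (rule M.integrable_const_bound[where B = B])
    show "AE x in M. norm (g (X x)) \<le> B"
      by (intro AE_I2) (simp only: real_norm_def B X)
  qed measurable
  have intY: "integrable Q (\<lambda>y. Y y ^ n)" for n
  proof (rule Q.integrable_const_bound[where B = 1])
    show "AE y in Q. norm (Y y ^ n) \<le> 1"
      by (intro AE_I2) (simp only: real_norm_def pow Y)
  qed measurable
  have intgY: "integrable Q (\<lambda>y. g (Y y))"
  proof (rule Q.integrable_const_bound[where B = B])
    show "AE y in Q. norm (g (Y y)) \<le> B"
      by (intro AE_I2) (simp only: real_norm_def B Y)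
  qed measurable
  have "\<bar>(\<integral>x. g (X x) \<partial>M) - (\<integral>y. g (Y y) \<partial>Q)\<bar> \<le> e" if e: "e > 0" for e
  proof -
    obtain p where p: "real_polynomial_function p" "\<And>t. t \<in> {0..1} \<Longrightarrow> \<bar>g t - p t\<bar> < e / 2"
      by (rule Stone_Weierstrass_real_polynomial_function[OF compact_Icc
          continuous_on_subset[OF g subset_UNIV] half_gt_zero[OF e]]) blast
    then obtain a n where pa: "p = (\<lambda>t. \<Sum>i\<le>n. a i * t ^ i)"
      using real_polynomial_function_iff_sum by blast
    have ipX: "integrable M (\<lambda>x. p (X x))"
      unfolding pa by (intro Bochner_Integration.integrable_sum integrable_mult_right intX)
    have ipY: "integrable Q (\<lambda>y. p (Y y))"
      unfolding pa by (intro Bochner_Integration.integrable_sum integrable_mult_right intY)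
    have "(\<integral>x. p (X x) \<partial>M) = (\<Sum>i\<le>n. a i * (\<integral>x. X x ^ i \<partial>M))"
      unfolding pa by (simp add: Bochner_Integration.integral_sum intX)
    moreover have "(\<integral>y. p (Y y) \<partial>Q) = (\<Sum>i\<le>n. a i * (\<integral>y. Y y ^ i \<partial>Q))"
      unfolding pa by (simp add: Bochner_Integration.integral_sum intY)
    ultimately have "(\<integral>x. p (X x) \<partial>M) = (\<integral>y. p (Y y) \<partial>Q)"
      by (simp only: moments)
    moreover have "\<bar>(\<integral>x. g (X x) \<partial>M) - (\<integral>x. p (X x) \<partial>M)\<bar> \<le> e / 2"
    proof -
      have "\<bar>\<integral>x. g (X x) - p (X x) \<partial>M\<bar> \<le> (\<integral>x. \<bar>g (X x) - p (X x)\<bar> \<partial>M)"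
        by (rule integral_abs_bound)
      also have "\<dots> \<le> (\<integral>x. e / 2 \<partial>M)"
      proof (rule integral_mono)
        show "integrable M (\<lambda>x. \<bar>g (X x) - p (X x)\<bar>)" using intgX ipX by simp
        show "\<bar>g (X x) - p (X x)\<bar> \<le> e / 2" if "x \<in> space M" for x
          using p(2)[OF X[OF that]] by (rule less_imp_le)
      qed simp
      finally show ?thesis using intgX ipX by (simp add: M.prob_space)
    qed
    moreover have "\<bar>(\<integral>y. g (Y y) \<partial>Q) - (\<integral>y. p (Y y) \<partial>Q)\<bar> \<le> e / 2"
    proof -
      have "\<bar>\<integral>y. g (Y y) - p (Y y) \<partial>Q\<bar> \<le> (\<integral>y. \<bar>g (Y y) - p (Y y)\<bar> \<partial>Q)"
        by (rule integral_abs_bound)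
      also have "\<dots> \<le> (\<integral>y. e / 2 \<partial>Q)"
      proof (rule integral_mono)
        show "integrable Q (\<lambda>y. \<bar>g (Y y) - p (Y y)\<bar>)" using intgY ipY by simp
        show "\<bar>g (Y y) - p (Y y)\<bar> \<le> e / 2" if "y \<in> space Q" for y
          using p(2)[OF Y[OF that]] by (rule less_imp_le)
      qed simp
      finally show ?thesis using intgY ipY by (simp add: Q.prob_space)
    qed
    ultimately show ?thesis by linarith
  qed
  then have "\<bar>(\<integral>x. g (X x) \<partial>M) - (\<integral>y. g (Y y) \<partial>Q)\<bar> \<le> 0"
    using field_le_epsilon[of "\<bar>(\<integral>x. g (X x) \<partial>M) - (\<integral>y. g (Y y) \<partial>Q)\<bar>" 0] by simp
  then show ?thesis by simp
qed

lemma unif01_periodic_shift: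
  fixes h :: "real \<Rightarrow> real"
  assumes h: "continuous_on UNIV h" and per: "\<And>t. h (t + 1) = h t"
  shows "(\<integral>t. h (t + s) \<partial>unif01) = (\<integral>t. h t \<partial>unif01)"
proof -
  have to_integral: "(\<integral>t. k t \<partial>unif01) = integral {0..1} k" if k: "continuous_on UNIV k" for k :: "real \<Rightarrow> real"
  proof -
    have "set_integrable lborel {0<..<1} k"
      by (rule set_integrable_subset[OF borel_integrable_atLeastAtMost'[of 0 1]])
        (use k continuous_on_subset in auto)
    then have "(LINT t:{0<..<1}|lborel. k t) = integral {0<..<1} k"
      by (rule set_borel_integral_eq_integral)
    also have "\<dots> = integral {0..1} k"
      using integral_open_interval_real[of 0 1 k] by simp
    finally show ?thesis
      by (subst integral_restrict_space) (auto simp: set_lebesgue_integral_def)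
  qed
  have int: "h integrable_on {a..b}" for a b
    using h by (intro integrable_continuous_real) (auto intro: continuous_on_subset)
  have shift: "integral {a..b} (\<lambda>t. h (t + c)) = integral {a + c..b + c} h" for a b c
    using integral_shift_Icc_real[of a b h c] by (simp add: o_def add.commute)
  \<comment> \<open>\<open>r\<close> is the shift modulo the period. The window from
    \<open>r\<close> to \<open>1 + r\<close> is then cut at 1 and its right-hand piece moved back by
    one period.\<close>
  define r where "r = frac s"
  have r: "0 \<le> r" "r \<le> 1" by (auto simp: r_def frac_lt_1 less_imp_le)
  have perN: "h (t + real n) = h t" for t n
  proof (induction n)
    case (Suc n)
    have "h (t + real (Suc n)) = h (t + real n)"
      using per[of "t + real n"] by (simp add: ac_simps)
    with Suc show ?case by simp
  qed simp
  have perZ: "h (t + real_of_int k) = h t" for t k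
  proof (cases "k \<ge> 0")
    case True
    then show ?thesis using perN[of t "nat k"] by simp
  next
    case False
    then show ?thesis using perN[of "t + real_of_int k" "nat (- k)"] by simp
  qed
  have "(\<integral>t. h (t + s) \<partial>unif01) = integral {0..1} (\<lambda>t. h (t + s))"
    by (rule to_integral) (intro continuous_on_compose2[OF h] continuous_intros subset_UNIV)
  also have "\<dots> = integral {0..1} (\<lambda>t. h (t + r))"
  proof -
    have "h (t + s) = h (t + r)" for t
      using perZ[of "t + r" "\<lfloor>s\<rfloor>"] by (simp add: r_def frac_def)
    then show ?thesis by simp
  qed
  also have "\<dots> = integral {r..1 + r} h"
    using shift[of 0 1 r] by simp
  also have "\<dots> = integral {r..1} h + integral {1..1 + r} h"
    using Henstock_Kurzweil_Integration.integral_combine[of r 1 "1 + r" h] r int by simp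
  also have "integral {1..1 + r} h = integral {0..r} h"
    using shift[of 0 r 1] unfolding per by (simp add: add.commute)
  also have "integral {r..1} h + integral {0..r} h = integral {0..1} h"
    using Henstock_Kurzweil_Integration.integral_combine[of 0 r 1 h] r int by simp
  also have "\<dots> = (\<integral>t. h t \<partial>unif01)"
    by (rule to_integral[OF h, symmetric])
  finally show ?thesis .
qed

text \<open>Invariance permits averaging over all angles. After Fubini the value \<open>z\<close> of
  \<open>v\<close> is fixed, and a periodic shift by \<open>Arg z / (2 * pi)\<close> absorbs its
  argument. Thus \<open>v\<close> has the law of a uniform phase times an independent copy of its
  modulus.\<close>

lemma rotation_average:
  fixes f :: "complex \<Rightarrow> real" and v :: "'a \<Rightarrow> complex"
  assumes M: "prob_space M" and v [measurable]: "v \<in> borel_measurable M"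
    and inv: "\<And>\<theta>. (\<integral>x. f (cis \<theta> * v x) \<partial>M) = (\<integral>x. f (v x) \<partial>M)"
    and f: "continuous_on UNIV f" and bdd: "bounded (range f)"
  shows "(\<integral>x. f (v x) \<partial>M) = (\<integral>t. (\<integral>x. f (cis (2 * pi * t) * of_real (cmod (v x))) \<partial>M) \<partial>unif01)"
proof -
  interpret M: prob_space M by fact
  interpret U: prob_space unif01 by (rule prob_space_unif01)
  interpret P: pair_prob_space M unif01 ..
  have fm [measurable]: "f \<in> borel_measurable borel"
    using f by (rule borel_measurable_continuous_onI)
  have cism [measurable]: "cis \<in> borel_measurable borel"
    by (intro borel_measurable_continuous_onI continuous_intros)
  have idm [measurable]: "(\<lambda>t. t) \<in> borel_measurable unif01"
    by (rule measurable_restrict_space1) simp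
  obtain B where B: "\<And>z. \<bar>f z\<bar> \<le> B"
    using bdd by (auto simp: bounded_iff)
  have i1: "integrable (M \<Otimes>\<^sub>M unif01) (\<lambda>(x, t). f (cis (2 * pi * t) * v x))"
    by (rule P.integrable_const_bound[where B = B]) (use B in auto)
  have i2: "integrable (M \<Otimes>\<^sub>M unif01) (\<lambda>(x, t). f (cis (2 * pi * t) * of_real (cmod (v x))))"
    by (rule P.integrable_const_bound[where B = B]) (use B in auto)
  have rot: "(\<integral>t. f (cis (2 * pi * t) * z) \<partial>unif01) = (\<integral>t. f (cis (2 * pi * t) * of_real (cmod z)) \<partial>unif01)" for z
  proof -
    have "(\<integral>t. (\<lambda>t. f (cis (2 * pi * t) * of_real (cmod z))) (t + Arg z / (2 * pi)) \<partial>unif01)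
        = (\<integral>t. f (cis (2 * pi * t) * of_real (cmod z)) \<partial>unif01)"
    proof (rule unif01_periodic_shift)
      show "continuous_on UNIV (\<lambda>t. f (cis (2 * pi * t) * of_real (cmod z)))"
        by (intro continuous_on_compose2[OF f] continuous_intros subset_UNIV)
      show "f (cis (2 * pi * (t + 1)) * of_real (cmod z)) = f (cis (2 * pi * t) * of_real (cmod z))" for t
        by (simp add: distrib_left cis_mult[symmetric])
    qed
    moreover have "cis (2 * pi * (t + Arg z / (2 * pi))) * of_real (cmod z) = cis (2 * pi * t) * z" for t
    proof -
      have "2 * pi * (t + Arg z / (2 * pi)) = 2 * pi * t + Arg z" by (simp add: field_simps)
      then have "cis (2 * pi * (t + Arg z / (2 * pi))) * of_real (cmod z) = cis (2 * pi * t) * rcis (cmod z) (Arg z)"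
        by (simp add: cis_mult[symmetric] rcis_def mult_ac)
      then show ?thesis by (simp add: rcis_cmod_Arg)
    qed
    ultimately show ?thesis by simp
  qed
  have "(\<integral>x. f (v x) \<partial>M) = (\<integral>t. (\<integral>x. f (cis (2 * pi * t) * v x) \<partial>M) \<partial>unif01)"
    unfolding inv by (subst lebesgue_integral_const) (simp only: U.prob_space scaleR_one)
  also have "\<dots> = (\<integral>x. (\<integral>t. f (cis (2 * pi * t) * v x) \<partial>unif01) \<partial>M)"
    using i1 by (rule P.Fubini_integral)
  also have "\<dots> = (\<integral>x. (\<integral>t. f (cis (2 * pi * t) * of_real (cmod (v x))) \<partial>unif01) \<partial>M)"
    by (intro Bochner_Integration.integral_cong refl rot)
  also have "\<dots> = (\<integral>t. (\<integral>x. f (cis (2 * pi * t) * of_real (cmod (v x))) \<partial>M) \<partial>unif01)"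
    by (rule P.Fubini_integral[OF i2, symmetric])
  finally show ?thesis .
qed

section \<open>The complex Gaussian law\<close>

text \<open>With one coordinate fixed, a shear is a translation of the other.\<close>

lemma lborel_shear:
  fixes t :: real
  shows "distr (lborel :: (real \<times> real) measure) lborel (\<lambda>(x, y). (x + t * y, y)) = lborel"
    and "distr (lborel :: (real \<times> real) measure) lborel (\<lambda>(x, y). (x, y + t * x)) = lborel"
proof -
  have affine: "(\<integral>\<^sup>+x. f (x + c) \<partial>lborel) = (\<integral>\<^sup>+x. f x \<partial>lborel)"
    if "f \<in> borel_measurable borel" for f :: "real \<Rightarrow> ennreal" and c :: real
    using nn_integral_real_affine[OF that, of 1 c] by (simp add: add.commute)
  have [measurable]: "(\<lambda>(x, y). (x + t * y, y)) \<in> borel \<rightarrow>\<^sub>M (borel :: (real \<times> real) measure)"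
    "(\<lambda>(x, y). (x, y + t * x)) \<in> borel \<rightarrow>\<^sub>M (borel :: (real \<times> real) measure)"
    unfolding case_prod_unfold by (intro borel_measurable_continuous_onI continuous_intros)+
  show "distr (lborel :: (real \<times> real) measure) lborel (\<lambda>(x, y). (x + t * y, y)) = lborel" (is "?D = _")
  proof (rule measure_eqI)
    fix A assume "A \<in> sets ?D"
    then have A [measurable]: "A \<in> sets (borel :: (real \<times> real) measure)" by simp
    have [measurable]: "(\<lambda>x. (x, y)) \<in> borel \<rightarrow>\<^sub>M (borel :: (real \<times> real) measure)" for y :: real
      by (intro borel_measurable_continuous_onI continuous_intros)
    have "emeasure ?D A = (\<integral>\<^sup>+z. indicator A z \<partial>?D)" by simp
    also have "\<dots> = (\<integral>\<^sup>+z. indicator A (case z of (x, y) \<Rightarrow> (x + t * y, y)) \<partial>(lborel \<Otimes>\<^sub>M lborel))"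
      by (subst nn_integral_distr) (simp_all add: lborel_prod)
    also have "\<dots> = (\<integral>\<^sup>+y. (\<integral>\<^sup>+x. indicator A (x + t * y, y) \<partial>lborel) \<partial>lborel)"
      by (subst lborel_pair.nn_integral_snd[symmetric]) (simp_all add: lborel_prod)
    also have "\<dots> = (\<integral>\<^sup>+y. (\<integral>\<^sup>+x. indicator A (x, y) \<partial>lborel) \<partial>lborel)"
      by (intro nn_integral_cong affine) measurable
    also have "\<dots> = (\<integral>\<^sup>+z. indicator A z \<partial>(lborel \<Otimes>\<^sub>M lborel))"
      by (subst lborel_pair.nn_integral_snd) (simp_all add: lborel_prod)
    finally show "emeasure ?D A = emeasure lborel A" by (simp add: lborel_prod)
  qed simp
  show "distr (lborel :: (real \<times> real) measure) lborel (\<lambda>(x, y). (x, y + t * x)) = lborel" (is "?D = _")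
  proof (rule measure_eqI)
    fix A assume "A \<in> sets ?D"
    then have A [measurable]: "A \<in> sets (borel :: (real \<times> real) measure)" by simp
    have [measurable]: "(\<lambda>y. (x, y)) \<in> borel \<rightarrow>\<^sub>M (borel :: (real \<times> real) measure)" for x :: real
      by (intro borel_measurable_continuous_onI continuous_intros)
    have "emeasure ?D A = (\<integral>\<^sup>+z. indicator A z \<partial>?D)" by simp
    also have "\<dots> = (\<integral>\<^sup>+z. indicator A (case z of (x, y) \<Rightarrow> (x, y + t * x)) \<partial>(lborel \<Otimes>\<^sub>M lborel))"
      by (subst nn_integral_distr) (simp_all add: lborel_prod)
    also have "\<dots> = (\<integral>\<^sup>+x. (\<integral>\<^sup>+y. indicator A (x, y + t * x) \<partial>lborel) \<partial>lborel)"
      by (subst lborel.nn_integral_fst[symmetric]) (simp_all add: lborel_prod)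
    also have "\<dots> = (\<integral>\<^sup>+x. (\<integral>\<^sup>+y. indicator A (x, y) \<partial>lborel) \<partial>lborel)"
      by (intro nn_integral_cong affine) measurable
    also have "\<dots> = (\<integral>\<^sup>+z. indicator A z \<partial>(lborel \<Otimes>\<^sub>M lborel))"
      by (subst lborel.nn_integral_fst) (simp_all add: lborel_prod)
    finally show "emeasure ?D A = emeasure lborel A" by (simp add: lborel_prod)
  qed simp
qed

text \<open>A rotation is a product of three shears unless its angle is an odd multiple of \<open>\<pi>\<close>; in that
  case it is the square of a rotation by a right angle.\<close>

lemma lborel_rotation:
  "distr (lborel :: (real \<times> real) measure) lborel
     (\<lambda>(x, y). (cos \<theta> * x - sin \<theta> * y, sin \<theta> * x + cos \<theta> * y)) = lborel"
proof -
  define T :: "real \<Rightarrow> real \<times> real \<Rightarrow> real \<times> real"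
    where "T = (\<lambda>\<theta> (x, y). (cos \<theta> * x - sin \<theta> * y, sin \<theta> * x + cos \<theta> * y))"
  have [measurable]: "T \<theta> \<in> borel \<rightarrow>\<^sub>M borel" for \<theta>
    unfolding T_def case_prod_unfold by (intro borel_measurable_continuous_onI continuous_intros)
  have good: "distr lborel lborel (T \<theta>) = lborel" if "cos (\<theta> / 2) \<noteq> 0" for \<theta>
  proof -
    \<comment> \<open>The classical factorisation of a rotation into shears, with factors
      \<open>- tan (\<theta> / 2)\<close>, \<open>sin \<theta>\<close> and again
      \<open>- tan (\<theta> / 2)\<close>.\<close>
    define t where "t = - tan (\<theta> / 2)"
    define S1 :: "real \<times> real \<Rightarrow> real \<times> real" where "S1 = (\<lambda>(x, y). (x + t * y, y))"
    define S2 :: "real \<times> real \<Rightarrow> real \<times> real" where "S2 = (\<lambda>(x, y). (x, y + sin \<theta> * x))"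
    have [measurable]: "S1 \<in> borel \<rightarrow>\<^sub>M borel" "S2 \<in> borel \<rightarrow>\<^sub>M borel"
      unfolding S1_def S2_def case_prod_unfold
      by (intro borel_measurable_continuous_onI continuous_intros)+
    have s: "sin \<theta> = 2 * sin (\<theta> / 2) * cos (\<theta> / 2)" and c: "cos \<theta> = 1 - 2 * (sin (\<theta> / 2))\<^sup>2"
      using sin_double[of "\<theta> / 2"] cos_double_sin[of "\<theta> / 2"] by simp_all
    have c': "1 + sin \<theta> * t = cos \<theta>"
      using that by (simp add: s c t_def tan_def power2_eq_square)
    have s': "t + t * cos \<theta> = - sin \<theta>"
    proof -
      have "1 + cos \<theta> = 2 * (cos (\<theta> / 2))\<^sup>2"
        using cos_double_cos[of "\<theta> / 2"] by simp
      then have "t * (1 + cos \<theta>) = - sin \<theta>"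
        using that by (simp add: t_def tan_def s power2_eq_square)
      then show ?thesis by (simp add: distrib_left)
    qed
    have "T \<theta> = S1 \<circ> (S2 \<circ> S1)"
    proof
      fix z :: "real \<times> real"
      obtain x y where z: "z = (x, y)" by (cases z)
      have "(x + t * y) + t * (y + sin \<theta> * (x + t * y)) = (1 + sin \<theta> * t) * x + (t + t * (1 + sin \<theta> * t)) * y"
        "y + sin \<theta> * (x + t * y) = sin \<theta> * x + (1 + sin \<theta> * t) * y"
        by (simp_all add: algebra_simps)
      then show "T \<theta> z = (S1 \<circ> (S2 \<circ> S1)) z"
        by (simp add: z T_def S1_def S2_def c' s')
    qed
    then have "distr lborel lborel (T \<theta>) = distr (distr (distr lborel lborel S1) lborel S2) lborel S1"
      by (simp add: distr_distr o_assoc)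
    then show ?thesis
      using lborel_shear(1)[of t] lborel_shear(2)[of "sin \<theta>"] by (simp add: S1_def S2_def)
  qed
  show ?thesis
  proof (cases "cos (\<theta> / 2) = 0")
    case False
    then show ?thesis using good by (simp add: T_def)
  next
    case True
    \<comment> \<open>If this cosine were 0, the double-angle formula would give
      \<open>cos (\<theta> / 2) = - 1\<close> instead of 0.\<close>
    have "cos (\<theta> / 2 / 2) \<noteq> 0"
      using cos_double_sin[of "\<theta> / 2 / 2"] cos_double_cos[of "\<theta> / 2 / 2"] True by auto
    then have half: "distr lborel lborel (T (\<theta> / 2)) = lborel" by (rule good)
    have "T \<theta> = T (\<theta> / 2) \<circ> T (\<theta> / 2)"
    proof -
      have c: "cos \<theta> = cos (\<theta> / 2) * cos (\<theta> / 2) - sin (\<theta> / 2) * sin (\<theta> / 2)"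
        and s: "sin \<theta> = sin (\<theta> / 2) * cos (\<theta> / 2) + cos (\<theta> / 2) * sin (\<theta> / 2)"
        using cos_add[of "\<theta> / 2" "\<theta> / 2"] sin_add[of "\<theta> / 2" "\<theta> / 2"] by simp_all
      show ?thesis
        by (auto simp: T_def fun_eq_iff c s ring_distribs mult_ac)
    qed
    then have "distr lborel lborel (T \<theta>) = distr (distr lborel lborel (T (\<theta> / 2))) lborel (T (\<theta> / 2))"
      by (simp add: distr_distr)
    then show ?thesis by (simp add: half) (simp add: T_def)
  qed
qed

text \<open>The disc of squared radius \<open>r\<close> has area \<open>pi * r\<close>. This takes
  the place of polar coordinates; half-lines generate the Borel sets and are closed under
  intersection.\<close>

lemma lborel_norm_square:
  "distr (lborel :: (real \<times> real) measure) borel (\<lambda>z. (norm z)\<^sup>2) =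
     density lborel (\<lambda>r. ennreal pi * indicator {0..} r)" (is "?D = ?E")
proof (rule measure_eqI_generator_eq[where E = "range atMost" and \<Omega> = UNIV and A = "\<lambda>n. {..real n}"])
  show "Int_stable (range atMost :: real set set)"
  proof (rule Int_stableI)
    fix A B :: "real set" assume "A \<in> range atMost" "B \<in> range atMost"
    then obtain a b where "A = {..a}" "B = {..b}" by auto
    then have "A \<inter> B = {..min a b}" by auto
    then show "A \<inter> B \<in> range atMost" by blast
  qed
  have D: "emeasure ?D {..r} = ennreal (pi * max 0 r)" for r
  proof (cases "r \<ge> 0")
    case True
    have "(\<lambda>z::real \<times> real. (norm z)\<^sup>2) -` {..r} = cball 0 (sqrt r)"
      using True by (auto simp: real_le_rsqrt intro: power2_le_imp_le) (metis norm_ge_zero power_mono real_sqrt_pow2)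
    then show ?thesis
      using True by (subst emeasure_distr) (auto simp: emeasure_cball unit_ball_vol_2)
  next
    case False
    then have "(\<lambda>z::real \<times> real. (norm z)\<^sup>2) -` {..r} = {}"
      by (auto simp: not_le) (metis less_le_trans zero_le_power2 not_le)
    then show ?thesis
      using False by (subst emeasure_distr) auto
  qed
  show "emeasure ?D X = emeasure ?E X" if "X \<in> range atMost" for X
  proof -
    obtain r where X: "X = {..r}" using \<open>X \<in> range atMost\<close> by auto
    have "emeasure ?E {..r} = (\<integral>\<^sup>+x. ennreal pi * indicator ({0..} \<inter> {..r}) x \<partial>lborel)"
      by (subst emeasure_density) (auto intro!: nn_integral_cong simp: indicator_def)
    also have "\<dots> = ennreal pi * emeasure lborel ({0..} \<inter> {..r})"
      by (subst nn_integral_cmult) auto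
    also have "{0..} \<inter> {..r} = {0..r}" by auto
    also have "ennreal pi * emeasure lborel {0..r} = ennreal (pi * max 0 r)"
      by (cases "r \<ge> 0") (auto simp: ennreal_mult max_def)
    finally show ?thesis by (simp add: X D)
  qed
  show "emeasure ?D {..real n} \<noteq> \<infinity>" for n by (simp add: D)
  show "(\<Union>n. {..real n}) = UNIV" using real_arch_simple by auto
  have "sets (borel :: real measure) = sigma_sets UNIV (range atMost)"
    by (subst borel_eq_atMost) (simp add: image_def)
  then show "sets ?D = sigma_sets UNIV (range atMost)" "sets ?E = sigma_sets UNIV (range atMost)"
    by simp_all
qed auto

section \<open>Modulus and rotation invariance of the complex Gaussian law\<close>

definition gauss_plane :: "(real \<times> real) measure" where
  "gauss_plane = density lborel (\<lambda>z. ennreal (exp (- (norm z)\<^sup>2) / pi))"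

lemma std_complex_gaussian_eq:
  "std_complex_gaussian = distr gauss_plane borel (\<lambda>(x, y). Complex x y)"
proof -
  interpret N: prob_space "density lborel (normal_density 0 (sqrt (1 / 2)))"
    by (rule prob_space_normal_density) simp
  have "density lborel (normal_density 0 (sqrt (1/2))) \<Otimes>\<^sub>M density lborel (normal_density 0 (sqrt (1/2)))
     = density (lborel \<Otimes>\<^sub>M lborel) (\<lambda>(x, y). ennreal (normal_density 0 (sqrt (1/2)) x) * ennreal (normal_density 0 (sqrt (1/2)) y))"
    by (rule pair_measure_density) (auto intro: lborel.sigma_finite_measure_axioms N.sigma_finite_measure_axioms)
  also have "(\<lambda>(x, y). ennreal (normal_density 0 (sqrt (1/2)) x) * ennreal (normal_density 0 (sqrt (1/2)) y))
      = (\<lambda>z. ennreal (exp (- (norm z)\<^sup>2) / pi))"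
    by (auto simp: fun_eq_iff normal_density_def norm_Pair ennreal_mult[symmetric] exp_minus exp_add
        field_simps)
  finally show ?thesis
    unfolding std_complex_gaussian_def gauss_plane_def lborel_prod by simp
qed

text \<open>The factor \<open>pi\<close> from the area of discs cancels the normalisation of the
  density, leaving \<open>exp (- r)\<close> on the half-line.\<close>

lemma gauss_plane_norm_square:
  "distributed gauss_plane lborel (\<lambda>z. (norm z)\<^sup>2) (exponential_density 1)"
  unfolding distributed_def
proof (intro conjI)
  have "distr gauss_plane lborel (\<lambda>z. (norm z)\<^sup>2) = distr gauss_plane borel (\<lambda>z. (norm z)\<^sup>2)"
    by (rule distr_cong) auto
  also have "\<dots> = density (distr lborel borel (\<lambda>z::real \<times> real. (norm z)\<^sup>2)) (\<lambda>r. ennreal (exp (- r) / pi))"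
    unfolding gauss_plane_def by (subst density_distr) auto
  also have "\<dots> = density lborel (\<lambda>r. ennreal pi * indicator {0..} r * ennreal (exp (- r) / pi))"
    unfolding lborel_norm_square by (subst density_density_eq) auto
  also have "(\<lambda>r. ennreal pi * indicator {0..} r * ennreal (exp (- r) / pi)) = (\<lambda>r. ennreal (exponential_density 1 r))"
    by (auto simp: fun_eq_iff exponential_density_def indicator_def ennreal_mult[symmetric])
  finally show "distr gauss_plane lborel (\<lambda>z. (norm z)\<^sup>2) = density lborel (exponential_density 1)" .
qed (auto simp: gauss_plane_def)

lemma prob_space_std_complex_gaussian: "prob_space std_complex_gaussian"
proof -
  interpret N: prob_space "density lborel (normal_density 0 (sqrt (1 / 2)))"
    by (rule prob_space_normal_density) simp
  interpret P: pair_prob_space "density lborel (normal_density 0 (sqrt (1 / 2)))"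
    "density lborel (normal_density 0 (sqrt (1 / 2)))" ..
  have "(\<lambda>(x, y). Complex x y) \<in> borel_measurable (density lborel (normal_density 0 (sqrt (1 / 2)))
      \<Otimes>\<^sub>M density lborel (normal_density 0 (sqrt (1 / 2))))"
    unfolding Complex_eq by measurable
  then show ?thesis
    unfolding std_complex_gaussian_def by (rule P.prob_space_distr)
qed

lemma Complex_pair_measurable [measurable]:
  "(\<lambda>(x, y). Complex x y) \<in> borel_measurable (borel :: (real \<times> real) measure)"
  unfolding case_prod_unfold by (intro borel_measurable_continuous_onI continuous_intros)

lemma std_complex_gaussian_norm_square:
  "distributed std_complex_gaussian lborel (\<lambda>z. (cmod z)\<^sup>2) (exponential_density 1)"
  unfolding distributed_def
proof (intro conjI)
  have "distr std_complex_gaussian lborel (\<lambda>z. (cmod z)\<^sup>2) = distr gauss_plane lborel (\<lambda>z. (norm z)\<^sup>2)"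
    unfolding std_complex_gaussian_eq
    by (subst distr_distr) (auto simp: gauss_plane_def cmod_def norm_Pair intro!: distr_cong)
  then show "distr std_complex_gaussian lborel (\<lambda>z. (cmod z)\<^sup>2) = density lborel (exponential_density 1)"
    using gauss_plane_norm_square by (simp add: distributed_def)
qed (auto simp: std_complex_gaussian_def)

text \<open>The density depends on the norm only, and rotations preserve planar Lebesgue
  measure.\<close>

lemma std_complex_gaussian_rotation:
  fixes f :: "complex \<Rightarrow> real"
  assumes [measurable]: "f \<in> borel_measurable borel"
  shows "(\<integral>z. f (cis \<theta> * z) \<partial>std_complex_gaussian) = (\<integral>z. f z \<partial>std_complex_gaussian)"
proof -
  define T :: "real \<times> real \<Rightarrow> real \<times> real"
    where "T = (\<lambda>(x, y). (cos \<theta> * x - sin \<theta> * y, sin \<theta> * x + cos \<theta> * y))"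
  have [measurable]: "T \<in> borel \<rightarrow>\<^sub>M borel"
    unfolding T_def case_prod_unfold by (intro borel_measurable_continuous_onI continuous_intros)
  define h where "h = (\<lambda>z. exp (- (norm z)\<^sup>2) / pi * f (case z of (x, y) \<Rightarrow> Complex x y))"
  have [measurable]: "h \<in> borel_measurable borel" unfolding h_def by measurable
  have int: "(\<integral>z. g z \<partial>std_complex_gaussian) = (\<integral>z. exp (- (norm z)\<^sup>2) / pi * g (case z of (x, y) \<Rightarrow> Complex x y) \<partial>lborel)"
    if [measurable]: "g \<in> borel_measurable borel" for g :: "complex \<Rightarrow> real"
    unfolding std_complex_gaussian_eq gauss_plane_def
    by (subst integral_distr) (auto simp: integral_density)
  have nT: "(norm (T z))\<^sup>2 = (norm z)\<^sup>2" for z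
  proof (cases z)
    case (Pair x y)
    have "(c * x - s * y)\<^sup>2 + (s * x + c * y)\<^sup>2 = (c\<^sup>2 + s\<^sup>2) * (x\<^sup>2 + y\<^sup>2)" for c s :: real
      by (simp add: power2_eq_square algebra_simps)
    from this[of "cos \<theta>" "sin \<theta>"] show ?thesis by (simp add: Pair T_def norm_Pair)
  qed
  have hT: "h (T z) = exp (- (norm z)\<^sup>2) / pi * f (cis \<theta> * (case z of (x, y) \<Rightarrow> Complex x y))" for z
  proof -
    have "(case T z of (x, y) \<Rightarrow> Complex x y) = cis \<theta> * (case z of (x, y) \<Rightarrow> Complex x y)"
      by (cases z) (simp add: T_def complex_eq_iff)
    then show ?thesis by (simp only: h_def nT)
  qed
  have "(\<integral>z. f (cis \<theta> * z) \<partial>std_complex_gaussian) = (\<integral>z. h (T z) \<partial>lborel)"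
    unfolding hT by (rule int) measurable
  also have "\<dots> = (\<integral>z. h z \<partial>distr lborel lborel T)"
    by (subst integral_distr) auto
  also have "\<dots> = (\<integral>z. f z \<partial>std_complex_gaussian)"
    unfolding T_def lborel_rotation by (subst int) (auto simp: h_def)
  finally show ?thesis .
qed

section \<open>Convergence in distribution\<close>

lemma unif01_measurable_id [measurable]: "(\<lambda>t. t) \<in> borel_measurable unif01"
  by (rule measurable_restrict_space1) simp

text \<open>Inverse transform sampling: \<open>- ln t\<close> is at most \<open>a\<close> exactly
  when \<open>t\<close> is at least \<open>exp (- a)\<close>, which has probability
  \<open>1 - exp (- a)\<close>.\<close>

lemma unif01_minus_ln: "distributed unif01 lborel (\<lambda>t. - ln t) (exponential_density 1)"
proof (rule exponential_distributedI)
  fix a :: real assume a: "0 \<le> a"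
  have "{t \<in> space unif01. - ln t \<le> a} = {exp (- a)..<1}"
  proof (intro equalityI subsetI)
    fix t assume "t \<in> {t \<in> space unif01. - ln t \<le> a}"
    then have "0 < t" "t < 1" "- a \<le> ln t" by (auto simp: space_restrict_space)
    then show "t \<in> {exp (- a)..<1}" by (simp add: ln_ge_iff)
  next
    fix t assume "t \<in> {exp (- a)..<1}"
    then have "0 < t" "t < 1" "exp (- a) \<le> t"
      using exp_gt_zero[of "- a"] by (auto simp del: exp_gt_zero)
    then show "t \<in> {t \<in> space unif01. - ln t \<le> a}"
      by (simp add: space_restrict_space) (use ln_ge_iff[of t "- a"] in linarith)
  qed
  moreover have "emeasure unif01 {exp (- a)..<1} = emeasure lborel {exp (- a)..<1}"
    by (rule emeasure_restrict_space) (use exp_gt_zero[of "- a"] in \<open>auto simp del: exp_gt_zero\<close>)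
  ultimately show "emeasure unif01 {t \<in> space unif01. - ln t \<le> a} = 1 - ennreal (exp (- a * 1))"
    using a by (simp add: ennreal_minus ennreal_1[symmetric] del: ennreal_1)
qed simp_all

lemma distributed_integral_eq:
  fixes g :: "real \<Rightarrow> real"
  assumes "distributed M lborel X D" "distributed Q lborel Y D" and [measurable]: "g \<in> borel_measurable borel"
  shows "(\<integral>x. g (X x) \<partial>M) = (\<integral>y. g (Y y) \<partial>Q)"
proof -
  have X: "X \<in> M \<rightarrow>\<^sub>M lborel" and Y: "Y \<in> Q \<rightarrow>\<^sub>M lborel"
    and eq: "distr M lborel X = distr Q lborel Y"
    using assms(1,2) by (auto simp: distributed_def)
  have "(\<integral>x. g (X x) \<partial>M) = (\<integral>r. g r \<partial>distr M lborel X)"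
    by (rule integral_distr[OF X, symmetric]) simp
  also have "\<dots> = (\<integral>y. g (Y y) \<partial>Q)"
    unfolding eq by (rule integral_distr[OF Y]) simp
  finally show ?thesis .
qed

text \<open>Any exponential variable \<open>S\<close> may carry the squared modulus. Taking it on
  the space of the approximating variables gives the limit the same shape as the right-hand side of
  \<open>rotation_invariant_law\<close>.\<close>

lemma std_complex_gaussian_polar:
  fixes f :: "complex \<Rightarrow> real"
  assumes f: "continuous_on UNIV f" and bdd: "bounded (range f)"
    and S: "distributed Q lborel S (exponential_density 1)"
  shows "(\<integral>z. f z \<partial>std_complex_gaussian)
    = (\<integral>t. (\<integral>y. f (cis (2 * pi * t) * of_real (sqrt (S y))) \<partial>Q) \<partial>unif01)"
proof -
  have fm [measurable]: "f \<in> borel_measurable borel"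
    using f by (rule borel_measurable_continuous_onI)
  have "(\<integral>z. f z \<partial>std_complex_gaussian)
    = (\<integral>t. (\<integral>z. f (cis (2 * pi * t) * of_real (cmod z)) \<partial>std_complex_gaussian) \<partial>unif01)"
    by (rule rotation_average[OF prob_space_std_complex_gaussian])
      (use f bdd std_complex_gaussian_rotation[OF fm] in \<open>auto simp: std_complex_gaussian_def\<close>)
  moreover have "(\<integral>z. f (cis (2 * pi * t) * of_real (cmod z)) \<partial>std_complex_gaussian)
    = (\<integral>y. f (cis (2 * pi * t) * of_real (sqrt (S y))) \<partial>Q)" for t
  proof -
    have "(\<lambda>r. f (cis (2 * pi * t) * of_real (sqrt r))) \<in> borel_measurable borel"
      by measurable
    from distributed_integral_eq[OF std_complex_gaussian_norm_square S this] show ?thesis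
      by simp
  qed
  ultimately show ?thesis by simp
qed

text \<open>Once the phase is averaged out, the integrand at a fixed angle is a continuous function
  of the squared modulus. That modulus is bounded by 1, so its moments allow it to be replaced by
  \<open>T\<close>.\<close>

lemma rotation_invariant_law:
  fixes f :: "complex \<Rightarrow> real" and v :: "'a \<Rightarrow> complex" and T :: "'b \<Rightarrow> real"
  assumes M: "prob_space M" and v [measurable]: "v \<in> borel_measurable M"
    and v1: "\<And>x. x \<in> space M \<Longrightarrow> cmod (v x) \<le> 1"
    and inv: "\<And>f \<theta>. continuous_on UNIV f \<Longrightarrow> (\<integral>x. f (cis \<theta> * v x) \<partial>M) = (\<integral>x. (f (v x) :: real) \<partial>M)"
    and Q: "prob_space Q" and T [measurable]: "T \<in> borel_measurable Q"
    and T1: "\<And>y. y \<in> space Q \<Longrightarrow> T y \<in> {0..1}"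
    and moments: "\<And>n. (\<integral>x. ((cmod (v x))\<^sup>2) ^ n \<partial>M) = (\<integral>y. T y ^ n \<partial>Q)"
    and f: "continuous_on UNIV f" and bdd: "bounded (range f)" and c: "c \<ge> 0"
  shows "(\<integral>x. f (of_real c * v x) \<partial>M)
    = (\<integral>t. (\<integral>y. f (cis (2 * pi * t) * of_real (sqrt (c\<^sup>2 * T y))) \<partial>Q) \<partial>unif01)"
proof -
  have "(\<integral>x. f (of_real c * v x) \<partial>M)
    = (\<integral>t. (\<integral>x. f (cis (2 * pi * t) * of_real (cmod (of_real c * v x))) \<partial>M) \<partial>unif01)"
  proof (rule rotation_average[OF M _ _ f bdd])
    show "(\<lambda>x. of_real c * v x) \<in> borel_measurable M" by measurable
    have "continuous_on UNIV (\<lambda>z. f (of_real c * z))"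
      by (intro continuous_on_compose2[OF f] continuous_intros subset_UNIV)
    from inv[OF this] show "(\<integral>x. f (cis \<theta> * (of_real c * v x)) \<partial>M) = (\<integral>x. f (of_real c * v x) \<partial>M)" for \<theta>
      by (simp add: mult.left_commute)
  qed
  moreover have "(\<integral>x. f (cis (2 * pi * t) * of_real (cmod (of_real c * v x))) \<partial>M)
     = (\<integral>y. f (cis (2 * pi * t) * of_real (sqrt (c\<^sup>2 * T y))) \<partial>Q)" for t
  proof -
    have g: "continuous_on UNIV (\<lambda>r. f (cis (2 * pi * t) * of_real (sqrt (c\<^sup>2 * r))))"
      by (intro continuous_on_compose2[OF f] continuous_intros subset_UNIV)
    have "(\<lambda>x. (cmod (v x))\<^sup>2) \<in> borel_measurable M" by measurable
    moreover have "(cmod (v x))\<^sup>2 \<in> {0..1}" if "x \<in> space M" for x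
      using v1[OF that] by (simp add: power_le_one_iff)
    ultimately have "(\<integral>x. f (cis (2 * pi * t) * of_real (sqrt (c\<^sup>2 * (cmod (v x))\<^sup>2))) \<partial>M)
      = (\<integral>y. f (cis (2 * pi * t) * of_real (sqrt (c\<^sup>2 * T y))) \<partial>Q)"
      by (intro moments_determine_integral[OF M Q _ T _ T1 moments g])
    then show ?thesis
      using c by (simp add: norm_mult real_sqrt_mult)
  qed
  ultimately show ?thesis by (simp only:)
qed

text \<open>All \<open>T n\<close> live on the single space \<open>Q\<close>, whereas the
  \<open>M n\<close> vary. Pointwise convergence on \<open>Q\<close> is therefore meaningful, and
  dominated convergence applies first at a fixed angle and then to the average over angles. The
  threshold \<open>K\<close> sets aside the small sizes.\<close>

lemma converges_to_std_complex_gaussian: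
  fixes f :: "complex \<Rightarrow> real" and v :: "nat \<Rightarrow> 'a \<Rightarrow> complex" and T :: "nat \<Rightarrow> 'b \<Rightarrow> real"
  assumes M: "\<And>n. n \<ge> K \<Longrightarrow> prob_space (M n)"
    and v: "\<And>n. n \<ge> K \<Longrightarrow> v n \<in> borel_measurable (M n)"
    and v1: "\<And>n x. n \<ge> K \<Longrightarrow> x \<in> space (M n) \<Longrightarrow> cmod (v n x) \<le> 1"
    and inv: "\<And>n f \<theta>. n \<ge> K \<Longrightarrow> continuous_on UNIV f \<Longrightarrow>
        (\<integral>x. f (cis \<theta> * v n x) \<partial>M n) = (\<integral>x. (f (v n x) :: real) \<partial>M n)"
    and Q: "prob_space Q" and T [measurable]: "\<And>n. T n \<in> borel_measurable Q"
    and T1: "\<And>n y. n \<ge> K \<Longrightarrow> y \<in> space Q \<Longrightarrow> T n y \<in> {0..1}"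
    and moments: "\<And>n m. n \<ge> K \<Longrightarrow> (\<integral>x. ((cmod (v n x))\<^sup>2) ^ m \<partial>M n) = (\<integral>y. T n y ^ m \<partial>Q)"
    and S: "distributed Q lborel S (exponential_density 1)"
    and lim: "\<And>y. y \<in> space Q \<Longrightarrow> (\<lambda>n. (c n)\<^sup>2 * T n y) \<longlonglongrightarrow> S y"
    and c: "\<And>n. c n \<ge> 0"
    and f: "continuous_on UNIV f" and bdd: "bounded (range f)"
  shows "(\<lambda>n. \<integral>x. f (of_real (c n) * v n x) \<partial>M n) \<longlonglongrightarrow> (\<integral>z. f z \<partial>std_complex_gaussian)"
proof -
  interpret Q: prob_space Q by fact
  interpret U: prob_space unif01 by (rule prob_space_unif01)
  have fm [measurable]: "f \<in> borel_measurable borel"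
    using f by (rule borel_measurable_continuous_onI)
  have cism [measurable]: "cis \<in> borel_measurable borel"
    by (intro borel_measurable_continuous_onI continuous_intros)
  have [measurable]: "S \<in> borel_measurable Q"
    using S by (auto simp: distributed_def)
  obtain B where B: "\<And>z. \<bar>f z\<bar> \<le> B"
    using bdd by (auto simp: bounded_iff)
  have "(\<lambda>n. \<integral>t. (\<integral>y. f (cis (2 * pi * t) * of_real (sqrt ((c n)\<^sup>2 * T n y))) \<partial>Q) \<partial>unif01)
     \<longlonglongrightarrow> (\<integral>t. (\<integral>y. f (cis (2 * pi * t) * of_real (sqrt (S y))) \<partial>Q) \<partial>unif01)"
  proof (rule integral_dominated_convergence[where w = "\<lambda>_. B"])
    show "(\<lambda>t. \<integral>y. f (cis (2 * pi * t) * of_real (sqrt (S y))) \<partial>Q) \<in> borel_measurable unif01"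
      by measurable
    show "(\<lambda>t. \<integral>y. f (cis (2 * pi * t) * of_real (sqrt ((c n)\<^sup>2 * T n y))) \<partial>Q) \<in> borel_measurable unif01" for n
      by measurable
    show "AE t in unif01. (\<lambda>n. \<integral>y. f (cis (2 * pi * t) * of_real (sqrt ((c n)\<^sup>2 * T n y))) \<partial>Q)
        \<longlonglongrightarrow> (\<integral>y. f (cis (2 * pi * t) * of_real (sqrt (S y))) \<partial>Q)"
    proof (rule AE_I2, rule integral_dominated_convergence[where w = "\<lambda>_. B"])
      fix t
      show "AE y in Q. (\<lambda>n. f (cis (2 * pi * t) * of_real (sqrt ((c n)\<^sup>2 * T n y))))
          \<longlonglongrightarrow> f (cis (2 * pi * t) * of_real (sqrt (S y)))"
      proof (rule AE_I2)
        fix y assume "y \<in> space Q"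
        then have "(\<lambda>n. cis (2 * pi * t) * of_real (sqrt ((c n)\<^sup>2 * T n y)))
            \<longlonglongrightarrow> cis (2 * pi * t) * of_real (sqrt (S y))"
          by (intro tendsto_intros lim)
        then show "(\<lambda>n. f (cis (2 * pi * t) * of_real (sqrt ((c n)\<^sup>2 * T n y))))
          \<longlonglongrightarrow> f (cis (2 * pi * t) * of_real (sqrt (S y)))"
          by (rule continuous_on_tendsto_compose[OF f]) auto
      qed
      show "AE y in Q. norm (f (cis (2 * pi * t) * of_real (sqrt ((c n)\<^sup>2 * T n y)))) \<le> B" for n
        by (intro AE_I2) (simp only: real_norm_def B)
    qed measurable
    show "AE t in unif01. norm (\<integral>y. f (cis (2 * pi * t) * of_real (sqrt ((c n)\<^sup>2 * T n y))) \<partial>Q) \<le> B" for n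
    proof (rule AE_I2)
      fix t
      have "\<bar>\<integral>y. f (cis (2 * pi * t) * of_real (sqrt ((c n)\<^sup>2 * T n y))) \<partial>Q\<bar>
        \<le> (\<integral>y. \<bar>f (cis (2 * pi * t) * of_real (sqrt ((c n)\<^sup>2 * T n y)))\<bar> \<partial>Q)"
        by (rule integral_abs_bound)
      also have "\<dots> \<le> B"
      proof (rule Q.integral_le_const)
        show "AE y in Q. \<bar>f (cis (2 * pi * t) * of_real (sqrt ((c n)\<^sup>2 * T n y)))\<bar> \<le> B"
          by (intro AE_I2 B)
        show "integrable Q (\<lambda>y. \<bar>f (cis (2 * pi * t) * of_real (sqrt ((c n)\<^sup>2 * T n y)))\<bar>)"
        proof (rule Q.integrable_const_bound[where B = B])
          show "AE y in Q. norm \<bar>f (cis (2 * pi * t) * of_real (sqrt ((c n)\<^sup>2 * T n y)))\<bar> \<le> B"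
            by (intro AE_I2) (simp only: real_norm_def abs_idempotent B)
        qed measurable
      qed
      finally show "norm (\<integral>y. f (cis (2 * pi * t) * of_real (sqrt ((c n)\<^sup>2 * T n y))) \<partial>Q) \<le> B"
        by simp
    qed
  qed simp
  moreover have "\<forall>\<^sub>F n in sequentially. (\<integral>x. f (of_real (c n) * v n x) \<partial>M n)
      = (\<integral>t. (\<integral>y. f (cis (2 * pi * t) * of_real (sqrt ((c n)\<^sup>2 * T n y))) \<partial>Q) \<partial>unif01)"
    by (intro eventually_sequentiallyI[of K] rotation_invariant_law)
      (use M v v1 inv Q T T1 moments f bdd c in auto)
  ultimately show ?thesis
    unfolding std_complex_gaussian_polar[OF f bdd S] by (rule Lim_transform_eventually[OF _ eventually_mono]) simp
qed

section \<open>Exact laws of the COE entries\<close>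

lemma haar_col_prod_rotation:
  fixes f :: "complex \<Rightarrow> 'b::{banach, second_countable_topology}"
  assumes haar: "haar_unitary N \<mu>" and ij: "i < N" "j < N" and f: "f \<in> borel_measurable borel"
  shows "(\<integral>U. f (cis \<theta> * col_prod N i j U) \<partial>\<mu>) = (\<integral>U. f (col_prod N i j U) \<partial>\<mu>)"
proof -
  \<comment> \<open>Half the angle suffices: \<open>col_prod\<close> is quadratic in the entries of
    \<open>U\<close> without conjugation, so the scalar matrix contributes its phase twice.\<close>
  define A where "A = mat N N (\<lambda>(k, l). if k = l then cis (\<theta> / 2) else 0)"
  have A: "A \<in> unitary_group N"
    unfolding unitary_group_iff
  proof (intro conjI allI impI)
    show "A \<in> carrier_mat N N" by (simp add: A_def)
    fix c d assume cd: "c < N" "d < N"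
    have "(\<Sum>k<N. cnj (A $$ (k, c)) * A $$ (k, d)) = (\<Sum>k<N. if k = c then (if c = d then 1 else 0) else 0)"
      using cd by (intro sum.cong) (auto simp: A_def cis_cnj cis_mult)
    then show "(\<Sum>k<N. cnj (A $$ (k, c)) * A $$ (k, d)) = (if c = d then 1 else 0)"
      using cd by simp
  qed
  have entry: "(A * U) $$ (k, c) = cis (\<theta> / 2) * U $$ (k, c)"
    if "U \<in> unitary_group N" "k < N" "c < N" for U k c
  proof -
    have "(A * U) $$ (k, c) = (\<Sum>l<N. A $$ (k, l) * U $$ (l, c))"
      using that A unitary_group_carrier by (intro mat_mult_entry) auto
    also have "\<dots> = (\<Sum>l<N. if l = k then cis (\<theta> / 2) * U $$ (k, c) else 0)"
      using that by (intro sum.cong) (auto simp: A_def)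
    finally show ?thesis using that by simp
  qed
  have "col_prod N i j (A * U) = cis \<theta> * col_prod N i j U" if "U \<in> unitary_group N" for U
  proof -
    have "col_prod N i j (A * U) = (\<Sum>k<N. (cis (\<theta> / 2) * cis (\<theta> / 2)) * (U $$ (k, i) * U $$ (k, j)))"
      unfolding col_prod_def using entry[OF that] ij by (intro sum.cong refl) (simp del: index_mult_mat(1) add: mult_ac)
    then show ?thesis
      by (simp add: cis_mult col_prod_def sum_distrib_left)
  qed
  then have "(\<integral>U. f (cis \<theta> * col_prod N i j U) \<partial>\<mu>) = (\<integral>U. f (col_prod N i j (A * U)) \<partial>\<mu>)"
    by (intro Bochner_Integration.integral_cong) (auto simp: haar_unitaryD(3)[OF haar])
  also have "\<dots> = (\<integral>U. f (col_prod N i j U) \<partial>\<mu>)"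
    by (rule haar_unitary_integral_mult[OF haar A measurable_compose[OF measurable_col_prod[OF ij] f]])
  finally show ?thesis .
qed

text \<open>Both sides equal 1 at \<open>m = 0\<close> and obey one recursion: multiplied by
  \<open>N - 1\<close>, the factor \<open>1 + (m + 1) * a\<close> with
  \<open>a = 2 / (N - 1)\<close> becomes \<open>N + 1 + 2 * m\<close>.\<close>

lemma diagonal_moments:
  assumes haar: "haar_unitary N \<mu>" and i: "i < N" and N: "N \<ge> 2"
  shows "(\<integral>U. ((cmod (col_prod N i i U))\<^sup>2) ^ m \<partial>\<mu>)
    = (\<integral>s. (1 - s powr (2 / (real N - 1))) ^ m \<partial>unif01)"
proof (induction m)
  case 0
  interpret prob_space \<mu> by (rule haar_unitaryD[OF haar])
  interpret U: prob_space unif01 by (rule prob_space_unif01)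
  show ?case
    unfolding power_0 lebesgue_integral_const prob_space U.prob_space ..
next
  case (Suc m)
  define a where "a = 2 / (real N - 1)"
  have N1: "real N - 1 > 0" using N by simp
  then have a: "a > 0" by (simp add: a_def)
  have a2: "(real N - 1) * a = 2"
    using N1 unfolding a_def times_divide_eq_right by (intro nonzero_mult_div_cancel_left) linarith
  define I where "I = (\<lambda>m. \<integral>s. (1 - s powr a) ^ m \<partial>unif01)"
  have "(real N - 1) * ((1 + real (Suc m) * a) * I (Suc m)) = (real N - 1) * (real (Suc m) * a * I m)"
    using unif01_one_minus_powr_rec[OF a, of m] by (simp only: I_def)
  moreover have "(real N - 1) * ((1 + real (Suc m) * a) * I (Suc m))
     = (real N - 1 + real (Suc m) * ((real N - 1) * a)) * I (Suc m)"
    "(real N - 1) * (real (Suc m) * a * I m) = real (Suc m) * ((real N - 1) * a) * I m"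
    by (simp_all add: algebra_simps)
  ultimately have "(real N - 1 + real (Suc m) * 2) * I (Suc m) = real (Suc m) * 2 * I m"
    by (simp only: a2)
  then have I: "(real N + 1 + 2 * real m) * I (Suc m) = 2 * real (Suc m) * I m"
    by (simp add: algebra_simps)
  have "(real N + 1 + 2 * real m) * (\<integral>U. ((cmod (col_prod N i i U))\<^sup>2) ^ Suc m \<partial>\<mu>)
      = (real N + 1 + 2 * real m) * I (Suc m)"
    unfolding I diagonal_moment_rec[OF haar i] using Suc by (simp only: I_def a_def)
  moreover have "real N + 1 + 2 * real m \<noteq> 0" by linarith
  ultimately show ?case by (simp only: mult_cancel_left I_def a_def simp_thms)
qed

text \<open>Here \<open>q powr (2 / (N - 1))\<close> represents \<open>1 - |p|^2\<close>, the
  squared length of the rest of the row of the unitary matrix \<open>U\<^sup>T * U\<close>. The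
  other factor is the share of \<open>v\<close> in it, and it is independent: the mixed moments
  factor.\<close>

lemma off_diagonal_moments:
  assumes haar: "haar_unitary N \<mu>" and ij: "i < N" "j < N" "i \<noteq> j" and N: "N \<ge> 3"
  shows "(\<integral>U. ((cmod (col_prod N i j U))\<^sup>2) ^ m \<partial>\<mu>)
    = (\<integral>y. (case y of (s, q) \<Rightarrow> q powr (2 / (real N - 1)) * (1 - s powr (1 / (real N - 2)))) ^ m
        \<partial>(unif01 \<Otimes>\<^sub>M unif01))"
proof -
  interpret prob_space \<mu> by (rule haar_unitaryD[OF haar])
  interpret U: prob_space unif01 by (rule prob_space_unif01)
  interpret P: pair_prob_space unif01 unif01 ..
  define a where "a = 2 / (real N - 1)"
  define b where "b = 1 / (real N - 2)"
  have N2: "real N - 2 > 0" using N by simp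
  then have b: "b > 0" "(real N - 2) * b = 1" by (simp_all add: b_def)
  have a: "a > 0" using N by (simp add: a_def)
  define I where "I = (\<lambda>m. \<integral>s. (1 - s powr b) ^ m \<partial>unif01)"
  define A where "A = (\<lambda>m k. \<integral>U. ((cmod (col_prod N i j U))\<^sup>2) ^ m * (1 - (cmod (col_prod N i i U))\<^sup>2) ^ k \<partial>\<mu>)"
  have I: "(real N - 1 + real m) * I (Suc m) = real (Suc m) * I m" for m
  proof -
    have "(real N - 2) * ((1 + real (Suc m) * b) * I (Suc m)) = (real N - 2) * (real (Suc m) * b * I m)"
      using unif01_one_minus_powr_rec[OF b(1), of m] by (simp only: I_def)
    moreover have "(real N - 2) * ((1 + real (Suc m) * b) * I (Suc m))
       = (real N - 2 + real (Suc m) * ((real N - 2) * b)) * I (Suc m)"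
      "(real N - 2) * (real (Suc m) * b * I m) = real (Suc m) * ((real N - 2) * b) * I m"
      by (simp_all add: algebra_simps)
    ultimately have "(real N - 2 + real (Suc m) * 1) * I (Suc m) = real (Suc m) * 1 * I m"
      by (simp only: b)
    then show ?thesis by (simp add: algebra_simps)
  qed
  \<comment> \<open>Each step of the recursion trades one power of \<open>|v|^2\<close> for one of
    \<open>1 - |p|^2\<close>, so \<open>m + k\<close> is preserved until \<open>m\<close> reaches
    0.\<close>
  have A: "A m k = I m * A 0 (m + k)" for m k
  proof (induction m arbitrary: k)
    case 0
    have "I 0 = 1" unfolding I_def power_0 lebesgue_integral_const U.prob_space by simp
    then show ?case by simp
  next
    case (Suc m)
    have "(real N - 1 + real m) * A (Suc m) k = real (Suc m) * A m (Suc k)"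
      unfolding A_def by (rule off_diagonal_moment_rec[OF haar ij])
    also have "\<dots> = (real (Suc m) * I m) * A 0 (Suc m + k)"
      by (simp only: Suc mult.assoc add_Suc_right add_Suc)
    also have "\<dots> = (real N - 1 + real m) * (I (Suc m) * A 0 (Suc m + k))"
      unfolding I[symmetric] by (simp only: mult.assoc)
    finally show ?case using N by (simp only: mult_cancel_left) auto
  qed
  have A0: "A 0 k = (\<integral>q. (q powr a) ^ k \<partial>unif01)" for k
  proof -
    \<comment> \<open>The diagonal law is known through the moments of \<open>|p|^2\<close>, while
      those of \<open>1 - |p|^2\<close> are wanted; integrating a polynomial in \<open>|p|^2\<close>
      converts one into the other.\<close>
    have "(\<integral>U. (1 - (cmod (col_prod N i i U))\<^sup>2) ^ k \<partial>\<mu>) = (\<integral>q. (1 - (1 - q powr a)) ^ k \<partial>unif01)"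
    proof (rule moments_determine_integral[where g = "\<lambda>r. (1 - r) ^ k"])
      show "(\<lambda>U. (cmod (col_prod N i i U))\<^sup>2) \<in> borel_measurable \<mu>"
        using ij haar_unitaryD(2)[OF haar] by (simp cong: measurable_cong_sets)
      show "(cmod (col_prod N i i U))\<^sup>2 \<in> {0..1}" if "U \<in> space \<mu>" for U
        using col_prod_bound[of U N i i] that ij haar_unitaryD(3)[OF haar] by (simp add: power_le_one_iff)
      show "1 - q powr a \<in> {0..1}" if "q \<in> space unif01" for q
        using one_minus_powr_bounds[of a q] a that by (simp add: space_restrict_space)
      show "(\<integral>U. ((cmod (col_prod N i i U))\<^sup>2) ^ n \<partial>\<mu>) = (\<integral>q. (1 - q powr a) ^ n \<partial>unif01)" for n
        unfolding a_def using N by (intro diagonal_moments[OF haar ij(1)]) simp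
      show "continuous_on UNIV (\<lambda>r::real. (1 - r) ^ k)" by (intro continuous_intros)
    qed (auto intro: prob_space_axioms U.prob_space_axioms)
    then show ?thesis by (simp add: A_def)
  qed
  have int: "integrable (unif01 \<Otimes>\<^sub>M unif01) (\<lambda>(s, q). (1 - s powr b) ^ m * (q powr a) ^ m)"
  proof (rule P.integrable_const_bound[where B = 1])
    show "AE y in unif01 \<Otimes>\<^sub>M unif01. norm (case y of (s, q) \<Rightarrow> (1 - s powr b) ^ m * (q powr a) ^ m) \<le> 1"
    proof (rule AE_I2)
      fix y assume "y \<in> space (unif01 \<Otimes>\<^sub>M unif01)"
      then obtain s q where y: "y = (s, q)" "0 < s" "s < 1" "0 < q" "q < 1"
        by (auto simp: space_pair_measure space_restrict_space)
      have "0 \<le> 1 - s powr b" "1 - s powr b \<le> 1" "0 \<le> q powr a" "q powr a \<le> 1"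
        using one_minus_powr_bounds[of b s] one_minus_powr_bounds[of a q] a b y by auto
      then show "norm (case y of (s, q) \<Rightarrow> (1 - s powr b) ^ m * (q powr a) ^ m) \<le> 1"
        by (auto simp: y abs_mult power_abs intro!: mult_le_one power_le_one)
    qed
  qed measurable
  have "(\<integral>U. ((cmod (col_prod N i j U))\<^sup>2) ^ m \<partial>\<mu>) = I m * (\<integral>q. (q powr a) ^ m \<partial>unif01)"
    using A[of m 0] A0[of m] by (simp add: A_def)
  also have "\<dots> = (\<integral>s. (\<integral>q. (1 - s powr b) ^ m * (q powr a) ^ m \<partial>unif01) \<partial>unif01)"
    by (simp add: I_def)
  also have "\<dots> = (\<integral>y. (case y of (s, q) \<Rightarrow> (1 - s powr b) ^ m * (q powr a) ^ m) \<partial>(unif01 \<Otimes>\<^sub>M unif01))"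
    using P.integral_fst'[OF int] by simp
  also have "\<dots> = (\<integral>y. (case y of (s, q) \<Rightarrow> q powr a * (1 - s powr b)) ^ m \<partial>(unif01 \<Otimes>\<^sub>M unif01))"
    by (intro Bochner_Integration.integral_cong) (auto simp: power_mult_distrib)
  finally show ?thesis by (simp only: a_def b_def)
qed

lemma coe_integral:
  fixes f :: "complex \<Rightarrow> 'c::{banach, second_countable_topology}"
  assumes haar: "haar_unitary N \<mu>" and V: "V \<in> M \<rightarrow>\<^sub>M mat_borel N"
    and eq: "distr M (mat_borel N) V = distr \<mu> (mat_borel N) (\<lambda>U. U\<^sup>T * U)"
    and ij: "i < N" "j < N" and f: "f \<in> borel_measurable borel"
  shows "(\<integral>\<omega>. f (V \<omega> $$ (i, j)) \<partial>M) = (\<integral>U. f (col_prod N i j U) \<partial>\<mu>)"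
proof -
  have entry: "(U\<^sup>T * U) $$ (k, l) = col_prod N k l U" if U: "U \<in> unitary_group N" and kl: "k < N" "l < N" for U k l
  proof -
    have c: "U \<in> carrier_mat N N" by (rule unitary_group_carrier[OF U])
    have "(U\<^sup>T * U) $$ (k, l) = (\<Sum>h<N. U\<^sup>T $$ (k, h) * U $$ (h, l))"
      by (rule mat_mult_entry) (use c kl in auto)
    then show ?thesis using c kl by (simp add: col_prod_def)
  qed
  have "(\<lambda>U. U\<^sup>T * U) \<in> unitary_borel N \<rightarrow>\<^sub>M mat_borel N"
  proof (rule measurable_into_mat_borel)
    show "U\<^sup>T * U \<in> carrier_mat N N" if "U \<in> space (unitary_borel N)" for U
      using that unitary_group_carrier by (intro mult_carrier_mat[of _ N N _ N]) auto
    fix k l assume kl: "k < N" "l < N"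
    show "(\<lambda>U. (U\<^sup>T * U) $$ (k, l)) \<in> borel_measurable (unitary_borel N)"
      using measurable_col_prod[OF kl]
      by (rule measurable_cong[THEN iffD1, rotated]) (use entry kl in \<open>auto simp del: index_mult_mat(1)\<close>)
  qed
  then have m: "(\<lambda>U. U\<^sup>T * U) \<in> \<mu> \<rightarrow>\<^sub>M mat_borel N"
    using haar_unitaryD(2)[OF haar] by (simp cong: measurable_cong_sets)
  have fm: "(\<lambda>A. f (A $$ (i, j))) \<in> borel_measurable (mat_borel N)"
    by (rule measurable_compose[OF measurable_mat_entry[OF ij] f])
  have "(\<integral>\<omega>. f (V \<omega> $$ (i, j)) \<partial>M) = (\<integral>A. f (A $$ (i, j)) \<partial>distr M (mat_borel N) V)"
    by (rule integral_distr[OF V fm, symmetric])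
  also have "\<dots> = (\<integral>U. f ((U\<^sup>T * U) $$ (i, j)) \<partial>\<mu>)"
    unfolding eq by (rule integral_distr[OF m fm])
  also have "\<dots> = (\<integral>U. f (col_prod N i j U) \<partial>\<mu>)"
    by (intro Bochner_Integration.integral_cong refl)
      (use entry ij haar_unitaryD(3)[OF haar] in \<open>auto simp del: index_mult_mat(1)\<close>)
  finally show ?thesis .
qed

text \<open>As \<open>e\<close> tends to 0, \<open>1 - s powr e\<close> behaves like
  \<open>- e * ln s\<close>. Both \<open>N / 2\<close> times \<open>2 / (N - 1)\<close> and
  \<open>N\<close> times \<open>1 / (N - 2)\<close> tend to 1, which is why the diagonal entry is
  scaled by half as much; the factor \<open>q powr (2 / (N - 1))\<close> tends to 1, so
  \<open>q\<close> leaves no trace.\<close>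

lemma tendsto_minus_ln:
  assumes "0 < s" "s < (1::real)" "0 < q"
  shows "(\<lambda>N. real N / 2 * (1 - s powr (2 / (real N - 1)))) \<longlonglongrightarrow> - ln s"
    and "(\<lambda>N. real N * (q powr (2 / (real N - 1)) * (1 - s powr (1 / (real N - 2))))) \<longlonglongrightarrow> - ln s"
proof -
  define L where "L = - ln s"
  have L: "L > 0" using assms by (simp add: L_def)
  define K where "K = ln q"
  have s: "s powr e = exp (- (e * L))" for e using assms by (simp add: powr_def L_def)
  have q: "q powr e = exp (e * K)" for e using assms by (simp add: powr_def K_def)
  have "(\<lambda>N. real N / 2 * (1 - exp (- (2 / (real N - 1) * L)))) \<longlonglongrightarrow> L"
    using L by real_asymp
  then show "(\<lambda>N. real N / 2 * (1 - s powr (2 / (real N - 1)))) \<longlonglongrightarrow> - ln s"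
    by (simp only: s L_def)
  have "(\<lambda>N. real N * (1 - exp (- (1 / (real N - 2) * L)))) \<longlonglongrightarrow> L"
    using L by real_asymp
  moreover have "(\<lambda>N. exp (2 / (real N - 1) * K)) \<longlonglongrightarrow> exp (0 * K)"
    by (intro tendsto_intros) real_asymp
  ultimately have "(\<lambda>N. exp (2 / (real N - 1) * K) * (real N * (1 - exp (- (1 / (real N - 2) * L)))))
      \<longlonglongrightarrow> exp (0 * K) * L"
    by (intro tendsto_mult)
  then show "(\<lambda>N. real N * (q powr (2 / (real N - 1)) * (1 - s powr (1 / (real N - 2))))) \<longlonglongrightarrow> - ln s"
    by (simp add: s q L_def mult.left_commute)
qed


(* Matrix indices of the library start at 0, hence the shift. *)
theorem corollary1p3:
  fixes i j :: nat
    and M :: "nat \<Rightarrow> 'a measure"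
    and V :: "nat \<Rightarrow> 'a \<Rightarrow> complex mat"
  assumes "i > 0" and "j > 0" and "i \<noteq> j"
    and "\<And>N. N \<ge> 1 \<Longrightarrow> coe_matrix N (M N) (V N)"
  shows "converges_in_distribution M
           (\<lambda>N \<omega>. complex_of_real (sqrt (real N / 2)) * V N \<omega> $$ (i - 1, i - 1))
           std_complex_gaussian \<and>
         converges_in_distribution M
           (\<lambda>N \<omega>. complex_of_real (sqrt (real N)) * V N \<omega> $$ (i - 1, j - 1))
           std_complex_gaussian"
proof -
  define k where "k = i - 1"
  define l where "l = j - 1"
  have kl: "k \<noteq> l" using assms(1-3) by (auto simp: k_def l_def)
  \<comment> \<open>From this size on both indices fit into the matrix, and the 3 keeps
    \<open>N - 2\<close> positive in the exponent of the off-diagonal law.\<close>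
  define n0 where "n0 = k + l + 3"
  have n0: "k < N" "l < N" "3 \<le> N" "2 \<le> N" if "N \<ge> n0" for N using that by (auto simp: n0_def)
  have "\<forall>N\<in>{1..}. \<exists>\<mu>. haar_unitary N \<mu> \<and>
      distr (M N) (mat_borel N) (V N) = distr \<mu> (mat_borel N) (\<lambda>U. U\<^sup>T * U)"
    using assms(4) by (auto simp: coe_matrix_def)
  then obtain \<mu> where \<mu>: "\<And>N. N \<ge> 1 \<Longrightarrow> haar_unitary N (\<mu> N)"
      "\<And>N. N \<ge> 1 \<Longrightarrow> distr (M N) (mat_borel N) (V N) = distr (\<mu> N) (mat_borel N) (\<lambda>U. U\<^sup>T * U)"
    by (metis atLeast_iff)
  have haar: "haar_unitary N (\<mu> N)" if "N \<ge> n0" for N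
    using \<mu>(1) that by (simp add: n0_def)
  have V: "V N \<in> M N \<rightarrow>\<^sub>M mat_borel N" if "N \<ge> n0" for N
    using assms(4)[of N] that by (simp add: n0_def coe_matrix_def)
  \<comment> \<open>The COE variables are replaced by functions of a Haar matrix for all large
    \<open>N\<close>; finitely many sizes do not affect the limit.\<close>
  have transfer: "converges_in_distribution M (\<lambda>N \<omega>. of_real (c N) * V N \<omega> $$ (k, m)) std_complex_gaussian"
    if m: "\<And>N. N \<ge> n0 \<Longrightarrow> m < N"
      and lim: "\<And>f :: complex \<Rightarrow> real. continuous_on UNIV f \<Longrightarrow> bounded (range f) \<Longrightarrow>
        (\<lambda>N. \<integral>U. f (of_real (c N) * col_prod N k m U) \<partial>\<mu> N) \<longlonglongrightarrow> (\<integral>z. f z \<partial>std_complex_gaussian)"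
    for m and c :: "nat \<Rightarrow> real"
    unfolding converges_in_distribution_def
  proof (intro allI impI)
    fix f :: "complex \<Rightarrow> real" assume f: "continuous_on UNIV f" "bounded (range f)"
    have "(\<integral>\<omega>. f (of_real (c N) * V N \<omega> $$ (k, m)) \<partial>M N) = (\<integral>U. f (of_real (c N) * col_prod N k m U) \<partial>\<mu> N)"
      if N: "N \<ge> n0" for N
    proof -
      have "(\<lambda>z. f (of_real (c N) * z)) \<in> borel_measurable borel"
        by (intro borel_measurable_continuous_onI continuous_on_compose2[OF f(1)] continuous_intros subset_UNIV)
      from coe_integral[OF haar[OF N] V[OF N] \<mu>(2) n0(1)[OF N] m[OF N] this] N
      show ?thesis by (simp add: n0_def)
    qed
    then show "(\<lambda>N. \<integral>\<omega>. f (of_real (c N) * V N \<omega> $$ (k, m)) \<partial>M N) \<longlonglongrightarrow> (\<integral>z. f z \<partial>std_complex_gaussian)"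
      by (intro Lim_transform_eventually[OF lim[OF f]] eventually_sequentiallyI[of n0]) simp
  qed
  have col_prod_measurable: "col_prod N k m \<in> borel_measurable (\<mu> N)" if "N \<ge> n0" "m < N" for N m
    using measurable_col_prod[OF n0(1)[OF that(1)] that(2)] haar_unitaryD(2)[OF haar[OF that(1)]]
    by (simp cong: measurable_cong_sets)
  have "converges_in_distribution M (\<lambda>N \<omega>. of_real (sqrt (real N / 2)) * V N \<omega> $$ (k, k)) std_complex_gaussian"
  proof (rule transfer[OF n0(1)])
    fix f :: "complex \<Rightarrow> real" assume f: "continuous_on UNIV f" "bounded (range f)"
    show "(\<lambda>N. \<integral>U. f (of_real (sqrt (real N / 2)) * col_prod N k k U) \<partial>\<mu> N) \<longlonglongrightarrow> (\<integral>z. f z \<partial>std_complex_gaussian)"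
    proof (rule converges_to_std_complex_gaussian[where K = n0 and Q = unif01
          and T = "\<lambda>N s. 1 - s powr (2 / (real N - 1))" and S = "\<lambda>s. - ln s", OF _ _ _ _ _ _ _ _ _ _ _ f])
      show "(\<lambda>s. 1 - s powr (2 / (real N - 1))) \<in> borel_measurable unif01" for N
        by measurable
      show "1 - s powr (2 / (real N - 1)) \<in> {0..1}" if "N \<ge> n0" "s \<in> space unif01" for N s
        using one_minus_powr_bounds[of "2 / (real N - 1)" s] that n0(4)[OF that(1)]
        by (simp add: space_restrict_space)
      show "(\<lambda>N. (sqrt (real N / 2))\<^sup>2 * (1 - s powr (2 / (real N - 1)))) \<longlonglongrightarrow> - ln s"
        if "s \<in> space unif01" for s
        using tendsto_minus_ln(1)[of s 1] that by (simp add: space_restrict_space)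
      show "(\<integral>U. f (cis \<theta> * col_prod N k k U) \<partial>\<mu> N) = (\<integral>U. f (col_prod N k k U) \<partial>\<mu> N)"
        if "N \<ge> n0" "continuous_on UNIV f" for N \<theta> and f :: "complex \<Rightarrow> real"
        using that by (intro haar_col_prod_rotation[OF haar] n0 borel_measurable_continuous_onI)
      show "cmod (col_prod N k k U) \<le> 1" if "N \<ge> n0" "U \<in> space (\<mu> N)" for N U
        using that haar_unitaryD(3)[OF haar] by (intro col_prod_bound n0) auto
    qed (use haar haar_unitaryD(1) prob_space_unif01 unif01_minus_ln diagonal_moments n0 col_prod_measurable in auto)
  qed
  moreover have "converges_in_distribution M (\<lambda>N \<omega>. of_real (sqrt (real N)) * V N \<omega> $$ (k, l)) std_complex_gaussian"
  proof (rule transfer[OF n0(2)])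
    interpret U: prob_space unif01 by (rule prob_space_unif01)
    interpret P: pair_prob_space unif01 unif01 ..
    fix f :: "complex \<Rightarrow> real" assume f: "continuous_on UNIV f" "bounded (range f)"
    show "(\<lambda>N. \<integral>U. f (of_real (sqrt (real N)) * col_prod N k l U) \<partial>\<mu> N) \<longlonglongrightarrow> (\<integral>z. f z \<partial>std_complex_gaussian)"
    \<comment> \<open>The law now needs two independent uniform variables, so \<open>Q\<close> is
      the unit square; the limit \<open>S\<close> involves only the first coordinate, the one that
      represents the share of \<open>v\<close>.\<close>
    proof (rule converges_to_std_complex_gaussian[where K = n0 and Q = "unif01 \<Otimes>\<^sub>M unif01"
          and T = "\<lambda>N y. case y of (s, q) \<Rightarrow> q powr (2 / (real N - 1)) * (1 - s powr (1 / (real N - 2)))"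
          and S = "\<lambda>y. - ln (fst y)", OF _ _ _ _ _ _ _ _ _ _ _ f])
      show "prob_space (unif01 \<Otimes>\<^sub>M unif01)" by (rule P.prob_space_axioms)
      show "(\<lambda>y. case y of (s, q) \<Rightarrow> q powr (2 / (real N - 1)) * (1 - s powr (1 / (real N - 2))))
          \<in> borel_measurable (unif01 \<Otimes>\<^sub>M unif01)" for N
        by measurable
      show "(case y of (s, q) \<Rightarrow> q powr (2 / (real N - 1)) * (1 - s powr (1 / (real N - 2)))) \<in> {0..1}"
        if N: "N \<ge> n0" and y0: "y \<in> space (unif01 \<Otimes>\<^sub>M unif01)" for N y
      proof -
        obtain s q where y: "y = (s, q)" "0 < s" "s < 1" "0 < q" "q < 1"
          using y0 by (auto simp: space_pair_measure space_restrict_space)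
        then show ?thesis
          using one_minus_powr_bounds[of "2 / (real N - 1)" q] one_minus_powr_bounds[of "1 / (real N - 2)" s]
            n0(3)[OF N] by (auto intro!: mult_le_one)
      qed
      show "(\<lambda>N. (sqrt (real N))\<^sup>2 * (case y of (s, q) \<Rightarrow> q powr (2 / (real N - 1)) * (1 - s powr (1 / (real N - 2)))))
          \<longlonglongrightarrow> - ln (fst y)" if "y \<in> space (unif01 \<Otimes>\<^sub>M unif01)" for y
        using that tendsto_minus_ln(2)[of "fst y" "snd y"]
        by (auto simp: space_pair_measure space_restrict_space)
      show "(\<integral>U. f (cis \<theta> * col_prod N k l U) \<partial>\<mu> N) = (\<integral>U. f (col_prod N k l U) \<partial>\<mu> N)"
        if "N \<ge> n0" "continuous_on UNIV f" for N \<theta> and f :: "complex \<Rightarrow> real"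
        using that by (intro haar_col_prod_rotation[OF haar] n0 borel_measurable_continuous_onI)
      show "cmod (col_prod N k l U) \<le> 1" if "N \<ge> n0" "U \<in> space (\<mu> N)" for N U
        using that haar_unitaryD(3)[OF haar] by (intro col_prod_bound n0) auto
      show "distributed (unif01 \<Otimes>\<^sub>M unif01) lborel (\<lambda>y. - ln (fst y)) (exponential_density 1)"
      proof -
        have "distr (unif01 \<Otimes>\<^sub>M unif01) lborel (\<lambda>y. - ln (fst y))
          = distr (distr (unif01 \<Otimes>\<^sub>M unif01) unif01 fst) lborel (\<lambda>s. - ln s)"
          by (subst distr_distr) (auto simp: o_def)
        also have "distr (unif01 \<Otimes>\<^sub>M unif01) unif01 fst = unif01"
          by (rule U.distr_pair_fst)
        finally show ?thesis
          using unif01_minus_ln by (simp add: distributed_def)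
      qed
      show "(\<integral>U. ((cmod (col_prod N k l U))\<^sup>2) ^ m \<partial>\<mu> N) = (\<integral>y. (case y of (s, q) \<Rightarrow>
          q powr (2 / (real N - 1)) * (1 - s powr (1 / (real N - 2)))) ^ m \<partial>(unif01 \<Otimes>\<^sub>M unif01))"
        if "N \<ge> n0" for N m
        by (intro off_diagonal_moments haar n0 kl that)
    qed (use haar haar_unitaryD(1) n0 col_prod_measurable in auto)
  qed
  ultimately show ?thesis by (simp add: k_def l_def)
qed

end
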